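(* A Hamel spray of nonzero scalar curvature is metrizable if and only if its adjoint Hamel function is a Finsler metric. In this case, the Hamel spray is uniquely induced by its adjoint Hamel function (the metric inducing it is unique up to a constant scaling).
   Context: A conical region $\mathcal{C}$ of $TM\setminus\{0\}$ is an open set such that each $\mathcal{C}_x=\mathcal{C}\cap (T_xM\setminus\{0\})$ is closed under $y\mapsto\lambda y$, $\lambda>0$. A spray on an $n$-dimensional manifold $M$ is a smooth vector field on a conical region, locally $\mathbf{G}=y^i\frac{\partial}{\partial x^i}-2G^i\frac{\partial}{\partial y^i}$ with $G^i$ positively homogeneous of degree two in $y$. Put $\partial_k=\partial/\partial x^k$, $\dot\partial_k=\partial/\partial y^k$, $G^r_i=\dot\partial_iG^r$, $G^r_{ij}=\dot\partial_j\dot\partial_iG^r$, $\delta_i=\partial_i-G^r_i\dot\partial_r$. For a function $f$: $f_{.i}=\dot\partial_if$, $f_{;i}=\delta_if$, $f_{;0}=f_{;i}y^i$, $f_{.i;j}=\delta_jf_{.i}-f_{.r}G^r_{ij}$, $f_{.i;0}=f_{.i;j}y^j$. Riemann curvature: $R^i_{\ k}=2\partial_kG^i-y^j\partial_j\dot\partial_kG^i+2G^j\dot\partial_j\dot\partial_kG^i-(\dot\partial_jG^i)(\dot\partial_kG^j)$; Ricci curvature: $Ric=R^i_{\ i}$. The spray is of scalar curvature if $R^i_{\ k}=R\delta^i_k-\tau_ky^i$ for some homogeneous functions $R(x,y),\tau_k(x,y)$; it is of nonzero scalar curvature if moreover its Ricci curvature $(n-1)R$ is nonzero. (For a Hamel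 spray of scalar curvature with adjoint Hamel function $Q$ the Riemann curvature is $\lambda(Q^2\delta^i_k-QQ_{.k}y^i)$, and nonzero scalar curvature means $\lambda\neq0$.) A Hamel function of a spray $\mathbf{G}$ is a function $Q$, positively homogeneous of degree one in $y$, with $Q_{;k}=Q_{.k;0}$. For a spray $\mathbf{G}$ and a nonzero Hamel function $Q$ of $\mathbf{G}$, the spray $\bar G^i:=G^i+\frac{Q_{;0}}{2Q}y^i$ is the Hamel spray associated to $(\mathbf{G},Q)$, and $Q$ is its adjoint Hamel function. A Finsler metric on $M$ is a $C^\infty$ function $L\ne0$ on a conical region, positively homogeneous of degree two in $y$, with $g_{ij}=(\frac12L)_{y^iy^j}$ nondegenerate. If $L=F^2>0$, $F$ is also called a Finsler metric; a degree-one homogeneous function $Q$ is a Finsler metric when $L=Q^2$ is. $L$ induces the spray $G^i=\frac14g^{il}\{L_{x^ky^l}y^k-L_{x^l}\}$. A spray is metrizable if it is induced by some Finsler metric.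
   Formalization: Uniqueness up to a constant scaling is stated on each connected subset of the conical region (globally if it is connected); on a disconnected region the metric can be rescaled independently on each component, so a single constant need not exist. *)

theory Defs
  imports "HOL-Analysis.Analysis"
begin

section \<open>Smooth maps between open subsets of Euclidean spaces\<close>

primrec times_differentiable_on ::
  "nat \<Rightarrow> 'a::euclidean_space set \<Rightarrow> ('a \<Rightarrow> 'b::euclidean_space) \<Rightarrow> bool" where
  "times_differentiable_on 0 S f \<longleftrightarrow> continuous_on S f"
| "times_differentiable_on (Suc k) S f \<longleftrightarrow>
     (\<forall>x\<in>S. f differentiable (at x)) \<and>
     (\<forall>v. times_differentiable_on k S (\<lambda>x. frechet_derivative f (at x) v))"

text \<open>Only used for open \<open>S\<close>; there it means \<open>C\<^sup>\<infinity>\<close>.\<close>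

definition smooth_on :: "'a::euclidean_space set \<Rightarrow> ('a \<Rightarrow> 'b::euclidean_space) \<Rightarrow> bool" where
  "smooth_on S f \<longleftrightarrow> (\<forall>k. times_differentiable_on k S f)"


section \<open>Smooth manifolds and their tangent bundles\<close>

text \<open>A chart is a pair of a coordinate domain \<open>U\<close> and a coordinate map \<open>\<phi>\<close>, which is relevant
  on \<open>U\<close> only. The manifold is the union of the domains of the charts of an atlas. The atlas need
  not be maximal.\<close>

type_synonym ('m, 'n) chart = "'m set \<times> ('m \<Rightarrow> real ^ 'n)"

definition is_chart :: "('m::topological_space, 'n::finite) chart \<Rightarrow> bool" where
  "is_chart c \<longleftrightarrow> open (fst c) \<and> open (snd c ` fst c) \<and>
     homeomorphism (fst c) (snd c ` fst c) (snd c) (inv_into (fst c) (snd c))"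

definition transition :: "('m, 'n::finite) chart \<Rightarrow> ('m, 'n) chart \<Rightarrow> real ^ 'n \<Rightarrow> real ^ 'n" where
  "transition c d = snd d \<circ> inv_into (fst c) (snd c)"

definition smooth_atlas :: "('m::topological_space, 'n::finite) chart set \<Rightarrow> bool" where
  "smooth_atlas A \<longleftrightarrow> (\<forall>c\<in>A. is_chart c) \<and>
     (\<forall>c\<in>A. \<forall>d\<in>A. smooth_on (snd c ` (fst c \<inter> fst d)) (transition c d))"

definition manifold :: "('m, 'n) chart set \<Rightarrow> 'm set" where
  "manifold A = (\<Union>c\<in>A. fst c)"

text \<open>A tangent vector at \<open>p\<close> is the pair of \<open>p\<close> and the family of its components with respect
  to all charts around \<open>p\<close>; these components transform by the Jacobians of the coordinate
  changes. The family is \<open>0\<close> by convention outside the charts around \<open>p\<close>.\<close>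

type_synonym ('m, 'n) tangent = "'m \<times> (('m, 'n) chart \<Rightarrow> real ^ 'n)"

definition tangent_bundle :: "('m, 'n::finite) chart set \<Rightarrow> ('m, 'n) tangent set" where
  "tangent_bundle A = {(p, \<xi>). p \<in> manifold A \<and>
     (\<forall>c\<in>A. \<forall>d\<in>A. p \<in> fst c \<inter> fst d \<longrightarrow>
        \<xi> d = frechet_derivative (transition c d) (at (snd c p)) (\<xi> c)) \<and>
     (\<forall>c. \<not> (c \<in> A \<and> p \<in> fst c) \<longrightarrow> \<xi> c = 0)}"

definition bundle_dom :: "('m, 'n::finite) chart set \<Rightarrow> ('m, 'n) chart \<Rightarrow> ('m, 'n) tangent set" where
  "bundle_dom A c = {v \<in> tangent_bundle A. fst v \<in> fst c}"

type_synonym 'n xy = "(real ^ 'n) \<times> (real ^ 'n)"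

text \<open>The induced coordinates \<open>(x, y)\<close> on the tangent bundle.\<close>

definition bundle_chart :: "('m, 'n::finite) chart \<Rightarrow> ('m, 'n) tangent \<Rightarrow> 'n xy" where
  "bundle_chart c v = (snd c (fst v), snd v c)"

definition bundle_transition ::
  "('m, 'n::finite) chart \<Rightarrow> ('m, 'n) chart \<Rightarrow> 'n xy \<Rightarrow> 'n xy" where
  "bundle_transition c d z =
     (transition c d (fst z), frechet_derivative (transition c d) (at (fst z)) (snd z))"

definition open_in_tangent_bundle ::
  "('m, 'n::finite) chart set \<Rightarrow> ('m, 'n) tangent set \<Rightarrow> bool" where
  "open_in_tangent_bundle A W \<longleftrightarrow> W \<subseteq> tangent_bundle A \<and>
     (\<forall>c\<in>A. open (bundle_chart c ` (W \<inter> bundle_dom A c)))"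

definition tangent_topology :: "('m, 'n::finite) chart set \<Rightarrow> ('m, 'n) tangent topology" where
  "tangent_topology A = topology (open_in_tangent_bundle A)"

lemma inj_on_bundle_chart:
  assumes "smooth_atlas A" "c \<in> A"
  shows "inj_on (bundle_chart c) (bundle_dom A c)"
proof (rule inj_onI)
  fix v w assume v: "v \<in> bundle_dom A c" and w: "w \<in> bundle_dom A c"
    and eq: "bundle_chart c v = bundle_chart c w"
  have "inj_on (snd c) (fst c)"
    using assms unfolding smooth_atlas_def is_chart_def homeomorphism_def
    by (metis inj_on_inverseI)
  then have p: "fst v = fst w"
    using v w eq by (auto simp: bundle_dom_def bundle_chart_def inj_on_def)
  have comp: "snd u d = (if d \<in> A \<and> fst u \<in> fst d
      then frechet_derivative (transition c d) (at (snd c (fst u))) (snd u c) else 0)"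
    if u: "u \<in> bundle_dom A c" for u d
  proof -
    obtain q \<xi> where q: "u = (q, \<xi>)" by (cases u)
    have "u \<in> tangent_bundle A" "q \<in> fst c"
      using u q by (auto simp only: bundle_dom_def mem_Collect_eq fst_conv)
    note tb = this(1)[unfolded q tangent_bundle_def mem_Collect_eq prod.case]
    note 1 = tb[THEN conjunct2, THEN conjunct1] and 2 = tb[THEN conjunct2, THEN conjunct2]
    show ?thesis
    proof (cases "d \<in> A \<and> q \<in> fst d")
      case True
      then show ?thesis using 1 \<open>c \<in> A\<close> \<open>q \<in> fst c\<close> unfolding q fst_conv snd_conv
        by (simp only: if_True simp_thms) blast
    next
      case False
      then show ?thesis using 2 unfolding q fst_conv snd_conv by (simp only: if_False) blast
    qed
  qed
  have "snd v c = snd w c" using eq by (simp only: bundle_chart_def prod.inject)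
  then have "snd v d = snd w d" for d
    by (simp only: comp[OF v, of d] comp[OF w, of d] p)
  then show "v = w" using p by (intro prod_eqI ext)
qed

lemma istopology_tangent:
  assumes A: "smooth_atlas A"
  shows "istopology (open_in_tangent_bundle A)"
  unfolding istopology_def
proof (intro conjI allI impI)
  fix S T assume S: "open_in_tangent_bundle A S" and T: "open_in_tangent_bundle A T"
  have "open (bundle_chart c ` (S \<inter> T \<inter> bundle_dom A c))" if c: "c \<in> A" for c
  proof -
    have "bundle_chart c ` ((S \<inter> bundle_dom A c) \<inter> (T \<inter> bundle_dom A c)) =
        bundle_chart c ` (S \<inter> bundle_dom A c) \<inter> bundle_chart c ` (T \<inter> bundle_dom A c)"
      by (rule inj_on_image_Int[OF inj_on_bundle_chart[OF A c]]) blast+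
    moreover have "(S \<inter> bundle_dom A c) \<inter> (T \<inter> bundle_dom A c) = S \<inter> T \<inter> bundle_dom A c" by blast
    moreover have "open (bundle_chart c ` (S \<inter> bundle_dom A c))"
      "open (bundle_chart c ` (T \<inter> bundle_dom A c))"
      using S T c unfolding open_in_tangent_bundle_def by blast+
    ultimately show ?thesis by (simp only: open_Int)
  qed
  then show "open_in_tangent_bundle A (S \<inter> T)"
    using S T unfolding open_in_tangent_bundle_def by blast
next
  fix K assume K: "\<forall>S\<in>K. open_in_tangent_bundle A S"
  have "open (bundle_chart c ` (\<Union>K \<inter> bundle_dom A c))" if c: "c \<in> A" for c
  proof -
    have "bundle_chart c ` (\<Union>K \<inter> bundle_dom A c) =
        (\<Union>S\<in>K. bundle_chart c ` (S \<inter> bundle_dom A c))" by auto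
    then show ?thesis using K c unfolding open_in_tangent_bundle_def by auto
  qed
  then show "open_in_tangent_bundle A (\<Union>K)"
    using K unfolding open_in_tangent_bundle_def by blast
qed

lemma openin_tangent_topology:
  "smooth_atlas A \<Longrightarrow> openin (tangent_topology A) W \<longleftrightarrow> open_in_tangent_bundle A W"
  by (simp add: tangent_topology_def istopology_tangent)


section \<open>Conical regions and coordinate expressions\<close>

definition tangent_scale :: "real \<Rightarrow> ('m, 'n::finite) tangent \<Rightarrow> ('m, 'n) tangent" where
  "tangent_scale t v = (fst v, \<lambda>c. t *\<^sub>R snd v c)"

definition conical_region :: "('m, 'n::finite) chart set \<Rightarrow> ('m, 'n) tangent set \<Rightarrow> bool" where
  "conical_region A C \<longleftrightarrow> openin (tangent_topology A) C \<and>
     (\<forall>v\<in>C. snd v \<noteq> (\<lambda>_. 0)) \<and> (\<forall>v\<in>C. \<forall>t>0. tangent_scale t v \<in> C)"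

definition in_coords ::
  "('m, 'n::finite) chart set \<Rightarrow> ('m, 'n) tangent set \<Rightarrow> ('m, 'n) chart \<Rightarrow> 'n xy set" where
  "in_coords A C c = bundle_chart c ` (C \<inter> bundle_dom A c)"

definition local_rep ::
  "('m, 'n::finite) chart set \<Rightarrow> ('m, 'n) chart \<Rightarrow> (('m, 'n) tangent \<Rightarrow> real) \<Rightarrow> 'n xy \<Rightarrow> real" where
  "local_rep A c f = f \<circ> inv_into (bundle_dom A c) (bundle_chart c)"

definition pos_homogeneous ::
  "nat \<Rightarrow> 'n::finite xy set \<Rightarrow> ('n xy \<Rightarrow> 'b::real_vector) \<Rightarrow> bool" where
  "pos_homogeneous k D f \<longleftrightarrow> (\<forall>(x, y)\<in>D. \<forall>t>0. f (x, t *\<^sub>R y) = t ^ k *\<^sub>R f (x, y))"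


section \<open>Differential operators in coordinates\<close>

text \<open>Here \<open>z = (x, y)\<close>; \<open>pdx k\<close> and \<open>pdy k\<close> are the partial derivatives with respect to
  \<open>x\<^sup>k\<close> and \<open>y\<^sup>k\<close>. A spray is given in coordinates by its coefficients
  \<open>G z $ i = G\<^sup>i(x, y)\<close>.\<close>

type_synonym 'n sprayc = "'n xy \<Rightarrow> real ^ 'n"

definition pdx :: "'n::finite \<Rightarrow> ('n xy \<Rightarrow> real) \<Rightarrow> 'n xy \<Rightarrow> real" where
  "pdx k f z = frechet_derivative f (at z) (axis k 1, 0)"

definition pdy :: "'n::finite \<Rightarrow> ('n xy \<Rightarrow> real) \<Rightarrow> 'n xy \<Rightarrow> real" where
  "pdy k f z = frechet_derivative f (at z) (0, axis k 1)"

definition coef :: "'n::finite sprayc \<Rightarrow> 'n \<Rightarrow> 'n xy \<Rightarrow> real" where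
  "coef G i z = G z $ i"

text \<open>\<open>conn1 G r i = G\<^sup>r\<^sub>i\<close> and \<open>conn2 G r i j = G\<^sup>r\<^sub>i\<^sub>j\<close>.\<close>

definition conn1 :: "'n::finite sprayc \<Rightarrow> 'n \<Rightarrow> 'n \<Rightarrow> 'n xy \<Rightarrow> real" where
  "conn1 G r i = pdy i (coef G r)"

definition conn2 :: "'n::finite sprayc \<Rightarrow> 'n \<Rightarrow> 'n \<Rightarrow> 'n \<Rightarrow> 'n xy \<Rightarrow> real" where
  "conn2 G r i j = pdy j (pdy i (coef G r))"

text \<open>\<open>hderiv G i f = f\<^sub>;\<^sub>i\<close>, \<open>hderiv0 G f = f\<^sub>;\<^sub>0\<close> and \<open>vhderiv G i j f = f\<^sub>.\<^sub>i\<^sub>;\<^sub>j\<close>,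
  \<open>vhderiv0 G i f = f\<^sub>.\<^sub>i\<^sub>;\<^sub>0\<close>.\<close>

definition hderiv ::
  "'n::finite sprayc \<Rightarrow> 'n \<Rightarrow> ('n xy \<Rightarrow> real) \<Rightarrow> 'n xy \<Rightarrow> real" where
  "hderiv G i f z = pdx i f z - (\<Sum>r\<in>UNIV. conn1 G r i z * pdy r f z)"

definition hderiv0 ::
  "'n::finite sprayc \<Rightarrow> ('n xy \<Rightarrow> real) \<Rightarrow> 'n xy \<Rightarrow> real" where
  "hderiv0 G f z = (\<Sum>i\<in>UNIV. hderiv G i f z * snd z $ i)"

definition vhderiv ::
  "'n::finite sprayc \<Rightarrow> 'n \<Rightarrow> 'n \<Rightarrow> ('n xy \<Rightarrow> real) \<Rightarrow> 'n xy \<Rightarrow> real" where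
  "vhderiv G i j f z = hderiv G j (pdy i f) z - (\<Sum>r\<in>UNIV. pdy r f z * conn2 G r i j z)"

definition vhderiv0 ::
  "'n::finite sprayc \<Rightarrow> 'n \<Rightarrow> ('n xy \<Rightarrow> real) \<Rightarrow> 'n xy \<Rightarrow> real" where
  "vhderiv0 G i f z = (\<Sum>j\<in>UNIV. vhderiv G i j f z * snd z $ j)"

definition riemann :: "'n::finite sprayc \<Rightarrow> 'n \<Rightarrow> 'n \<Rightarrow> 'n xy \<Rightarrow> real" where
  "riemann G i k z =
     2 * pdx k (coef G i) z
     - (\<Sum>j\<in>UNIV. snd z $ j * pdx j (pdy k (coef G i)) z)
     + 2 * (\<Sum>j\<in>UNIV. coef G j z * pdy j (pdy k (coef G i)) z)
     - (\<Sum>j\<in>UNIV. pdy j (coef G i) z * pdy k (coef G j) z)"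

definition ricci :: "'n::finite sprayc \<Rightarrow> 'n xy \<Rightarrow> real" where
  "ricci G z = (\<Sum>i\<in>UNIV. riemann G i i z)"


section \<open>Sprays, Hamel functions and Finsler metrics on manifolds\<close>

text \<open>The coefficients \<open>G c\<close> in the charts \<open>c\<close> define one vector field
  \<open>y\<^sup>i \<partial>/\<partial>x\<^sup>i - 2 G\<^sup>i \<partial>/\<partial>y\<^sup>i\<close> on \<open>C\<close>: the component vectors \<open>(y, - 2 G)\<close>
  correspond to each other under the derivatives of the changes of bundle coordinates.\<close>

definition spray ::
  "('m::topological_space, 'n::finite) chart set \<Rightarrow> ('m, 'n) tangent set \<Rightarrow>
   (('m, 'n) chart \<Rightarrow> 'n sprayc) \<Rightarrow> bool" where
  "spray A C G \<longleftrightarrow> conical_region A C \<and>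
     (\<forall>c\<in>A. smooth_on (in_coords A C c) (G c) \<and> pos_homogeneous 2 (in_coords A C c) (G c)) \<and>
     (\<forall>c\<in>A. \<forall>d\<in>A. \<forall>z \<in> bundle_chart c ` (C \<inter> bundle_dom A c \<inter> bundle_dom A d).
        frechet_derivative (bundle_transition c d) (at z) (snd z, - 2 *\<^sub>R G c z) =
          (snd (bundle_transition c d z), - 2 *\<^sub>R G d (bundle_transition c d z)))"

text \<open>The degrees of homogeneity are forced: \<open>R\<^sup>i\<^sub>k\<close> has degree two.\<close>

definition scalar_curvature ::
  "('m, 'n::finite) chart set \<Rightarrow> ('m, 'n) tangent set \<Rightarrow> (('m, 'n) chart \<Rightarrow> 'n sprayc) \<Rightarrow> bool" where
  "scalar_curvature A C G \<longleftrightarrow>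
     (\<forall>c\<in>A. \<exists>R \<tau>. pos_homogeneous 2 (in_coords A C c) R \<and>
        (\<forall>k. pos_homogeneous 1 (in_coords A C c) (\<tau> k)) \<and>
        (\<forall>z\<in>in_coords A C c. \<forall>i k.
           riemann (G c) i k z = R z * (if i = k then 1 else 0) - \<tau> k z * snd z $ i))"

definition nonzero_scalar_curvature ::
  "('m, 'n::finite) chart set \<Rightarrow> ('m, 'n) tangent set \<Rightarrow> (('m, 'n) chart \<Rightarrow> 'n sprayc) \<Rightarrow> bool" where
  "nonzero_scalar_curvature A C G \<longleftrightarrow> scalar_curvature A C G \<and>
     (\<forall>c\<in>A. \<forall>z\<in>in_coords A C c. ricci (G c) z \<noteq> 0)"

definition hamel_function ::
  "('m, 'n::finite) chart set \<Rightarrow> ('m, 'n) tangent set \<Rightarrow> (('m, 'n) chart \<Rightarrow> 'n sprayc) \<Rightarrow>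
   (('m, 'n) tangent \<Rightarrow> real) \<Rightarrow> bool" where
  "hamel_function A C G Q \<longleftrightarrow>
     (\<forall>c\<in>A. smooth_on (in_coords A C c) (local_rep A c Q) \<and>
        pos_homogeneous 1 (in_coords A C c) (local_rep A c Q) \<and>
        (\<forall>z\<in>in_coords A C c. \<forall>k.
           hderiv (G c) k (local_rep A c Q) z = vhderiv0 (G c) k (local_rep A c Q) z))"

definition associated_hamel_spray ::
  "('m, 'n::finite) chart set \<Rightarrow> (('m, 'n) chart \<Rightarrow> 'n sprayc) \<Rightarrow> (('m, 'n) tangent \<Rightarrow> real) \<Rightarrow>
   ('m, 'n) chart \<Rightarrow> 'n sprayc" where
  "associated_hamel_spray A G Q c z =
     G c z + (hderiv0 (G c) (local_rep A c Q) z / (2 * local_rep A c Q z)) *\<^sub>R snd z"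

definition fundamental_tensor ::
  "('n::finite xy \<Rightarrow> real) \<Rightarrow> 'n xy \<Rightarrow> real ^ 'n ^ 'n" where
  "fundamental_tensor L z = (\<chi> i j. pdy j (pdy i (\<lambda>w. L w / 2)) z)"

definition finsler_metric ::
  "('m, 'n::finite) chart set \<Rightarrow> ('m, 'n) tangent set \<Rightarrow> (('m, 'n) tangent \<Rightarrow> real) \<Rightarrow> bool" where
  "finsler_metric A C L \<longleftrightarrow> conical_region A C \<and> (\<forall>v\<in>C. L v \<noteq> 0) \<and>
     (\<forall>c\<in>A. smooth_on (in_coords A C c) (local_rep A c L) \<and>
        pos_homogeneous 2 (in_coords A C c) (local_rep A c L) \<and>
        (\<forall>z\<in>in_coords A C c. invertible (fundamental_tensor (local_rep A c L) z)))"

definition metric_spray :: "('n xy \<Rightarrow> real) \<Rightarrow> 'n::finite sprayc" where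
  "metric_spray L z = (\<chi> i. (1/4) * (\<Sum>l\<in>UNIV. matrix_inv (fundamental_tensor L z) $ i $ l *
     ((\<Sum>k\<in>UNIV. pdy l (pdx k L) z * snd z $ k) - pdx l L z)))"

definition induces ::
  "('m, 'n::finite) chart set \<Rightarrow> ('m, 'n) tangent set \<Rightarrow> (('m, 'n) tangent \<Rightarrow> real) \<Rightarrow>
   (('m, 'n) chart \<Rightarrow> 'n sprayc) \<Rightarrow> bool" where
  "induces A C L G \<longleftrightarrow>
     (\<forall>c\<in>A. \<forall>z\<in>in_coords A C c. G c z = metric_spray (local_rep A c L) z)"

definition metrizable ::
  "('m, 'n::finite) chart set \<Rightarrow> ('m, 'n) tangent set \<Rightarrow> (('m, 'n) chart \<Rightarrow> 'n sprayc) \<Rightarrow> bool" where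
  "metrizable A C G \<longleftrightarrow> (\<exists>L. finsler_metric A C L \<and> induces A C L G)"

end

theory Submission
  imports Defs
begin

text \<open>In a chart write \<open>S = y\<^sup>i \<partial>/\<partial>x\<^sup>i - 2 G\<^sup>i \<partial>/\<partial>y\<^sup>i\<close> for the spray as a vector field, and
  call a function \<open>f\<close> horizontally constant if all \<open>f\<^sub>;\<^sub>k\<close> vanish. Everything rests on three facts.

  First, commuting \<open>S\<close> with the partial derivatives turns the coordinate formulas into short
  identities. The spray is induced by a Finsler metric \<open>L\<close> exactly if \<open>S(L\<^sub>.\<^sub>l) = \<partial>\<^sub>l L\<close>, the
  Euler-Lagrange equation (\<open>along_geodesic_euler_lagrange\<close>); by homogeneity this holds if and only
  if \<open>L\<close> is horizontally constant (\<open>horizontally_constant_imp_euler_lagrange\<close>,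
  \<open>euler_lagrange_imp_horizontally_constant\<close>).

  Second, the adjoint Hamel function \<open>Q\<close> is horizontally constant for the associated Hamel spray
  (\<open>hamel_spray\<close>): the Hamel equation says that the vertical derivative of \<open>Q\<^sub>;\<^sub>0\<close> in direction \<open>k\<close>
  is \<open>2 Q\<^sub>;\<^sub>k\<close>, and this is the amount by which the projective change with factor
  \<open>Q\<^sub>;\<^sub>0 / (2 Q)\<close> lowers \<open>2 Q\<^sub>;\<^sub>k\<close>. So \<open>Q\<^sup>2\<close> is horizontally constant as well, and it induces the
  Hamel spray as soon as its fundamental tensor is invertible.

  Third, if \<open>f\<close> is horizontally constant, then \<open>R\<^sup>i\<^sub>k f\<^sub>.\<^sub>i = 0\<close>
  (\<open>riemann_annihilates_horizontally_constant\<close>). Let \<open>L\<close> be any Finsler metric that induces the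
  Hamel spray. The quotient \<open>f = L / Q\<^sup>2\<close> is horizontally constant and homogeneous of degree zero,
  so \<open>y\<^sup>i f\<^sub>.\<^sub>i = 0\<close>, and scalar curvature leaves \<open>R f\<^sub>.\<^sub>k = 0\<close>. Nonzero curvature gives \<open>f\<^sub>.\<^sub>k = 0\<close>,
  then \<open>\<partial>\<^sub>k f = f\<^sub>;\<^sub>k + G\<^sup>r\<^sub>k f\<^sub>.\<^sub>r = 0\<close>, and \<open>f\<close> is locally constant
  (\<open>horizontally_constant_unique\<close>). Hence \<open>Q\<^sup>2\<close> has an invertible fundamental tensor because \<open>L\<close>
  does, and \<open>L\<close> is a constant multiple of \<open>Q\<^sup>2\<close> on every connected set.\<close>


section \<open>Calculus of smooth functions\<close>

lemma times_differentiable_on_cong: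
  assumes "open S" "\<And>x. x \<in> S \<Longrightarrow> f x = g x" "times_differentiable_on k S f"
  shows "times_differentiable_on k S g"
  using assms(2,3)
proof (induction k arbitrary: f g)
  case 0
  then show ?case by (simp cong: continuous_on_cong)
next
  case (Suc k)
  have diff: "g differentiable (at x)"
    and deriv: "frechet_derivative f (at x) = frechet_derivative g (at x)" if x: "x \<in> S" for x
  proof -
    have f: "f differentiable (at x)" using Suc.prems x by simp
    then have "(g has_derivative frechet_derivative f (at x)) (at x)"
      using has_derivative_transform_within_open[OF _ \<open>open S\<close> x, of f _ UNIV g] Suc.prems(1)
      by (simp add: frechet_derivative_works)
    then show "g differentiable (at x)"
      and "frechet_derivative f (at x) = frechet_derivative g (at x)"
      by (auto simp: differentiable_def intro: frechet_derivative_at)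
  qed
  have "times_differentiable_on k S (\<lambda>x. frechet_derivative g (at x) v)" for v
    by (rule Suc.IH[of "\<lambda>x. frechet_derivative f (at x) v"]) (use Suc.prems deriv in auto)
  then show ?case using diff by simp
qed

lemma times_differentiable_on_Suc_imp:
  "times_differentiable_on (Suc k) S f \<Longrightarrow> times_differentiable_on k S f"
proof (induction k arbitrary: f)
  case 0
  then show ?case
    by (auto intro!: continuous_at_imp_continuous_on differentiable_imp_continuous_within)
next
  case (Suc k)
  then show ?case by (metis times_differentiable_on.simps(2))
qed

lemma times_differentiable_on_add:
  assumes "open S" "times_differentiable_on k S f" "times_differentiable_on k S g"
  shows "times_differentiable_on k S (\<lambda>x. f x + g x)"
  using assms(2,3)
proof (induction k arbitrary: f g)
  case 0
  then show ?case by (simp add: continuous_on_add)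
next
  case (Suc k)
  have "frechet_derivative (\<lambda>x. f x + g x) (at x) =
      (\<lambda>v. frechet_derivative f (at x) v + frechet_derivative g (at x) v)" if "x \<in> S" for x
    by (rule frechet_derivative_at[symmetric], rule has_derivative_add)
      (use Suc.prems that in \<open>auto simp: frechet_derivative_works\<close>)
  note deriv = this
  have "times_differentiable_on k S (\<lambda>x. frechet_derivative (\<lambda>x. f x + g x) (at x) v)" for v
  proof (rule times_differentiable_on_cong[OF \<open>open S\<close>])
    show "times_differentiable_on k S
        (\<lambda>x. frechet_derivative f (at x) v + frechet_derivative g (at x) v)"
      by (rule Suc.IH) (use Suc.prems in simp_all)
  qed (simp add: deriv)
  then show ?case using Suc.prems by (auto intro: differentiable_add)
qed

lemma times_differentiable_on_bounded_linear:
  assumes "bounded_linear l" "open S" "times_differentiable_on k S f"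
  shows "times_differentiable_on k S (\<lambda>x. l (f x))"
  using assms(3)
proof (induction k arbitrary: f)
  case 0
  then show ?case using assms(1) by (simp add: bounded_linear.continuous_on)
next
  case (Suc k)
  have *: "((\<lambda>x. l (f x)) has_derivative (\<lambda>v. l (frechet_derivative f (at x) v))) (at x)"
    if "x \<in> S" for x
    by (rule bounded_linear.has_derivative[OF assms(1)])
      (use Suc.prems that in \<open>auto simp: frechet_derivative_works\<close>)
  have "times_differentiable_on k S (\<lambda>x. frechet_derivative (\<lambda>x. l (f x)) (at x) v)" for v
  proof (rule times_differentiable_on_cong[OF \<open>open S\<close>])
    show "times_differentiable_on k S (\<lambda>x. l (frechet_derivative f (at x) v))"
      by (rule Suc.IH) (use Suc.prems in simp)
  qed (simp add: frechet_derivative_at[OF *, symmetric])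
  then show ?case using * by (auto simp: differentiable_def)
qed

text \<open>The product rule expresses the derivative by products of functions of the next lower order of
  differentiability, which is what makes the induction close.\<close>

lemma times_differentiable_on_bounded_bilinear:
  assumes "bounded_bilinear b" "open S"
    and "times_differentiable_on k S f" "times_differentiable_on k S g"
  shows "times_differentiable_on k S (\<lambda>x. b (f x) (g x))"
  using assms(3,4)
proof (induction k arbitrary: f g)
  case 0
  then show ?case using assms(1) by (simp add: bounded_bilinear.continuous_on)
next
  case (Suc k)
  have *: "((\<lambda>x. b (f x) (g x)) has_derivative
      (\<lambda>v. b (f x) (frechet_derivative g (at x) v) + b (frechet_derivative f (at x) v) (g x))) (at x)"
    if "x \<in> S" for x
    by (rule bounded_bilinear.FDERIV[OF assms(1)])
      (use Suc.prems that in \<open>auto simp: frechet_derivative_works\<close>)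
  have lower: "times_differentiable_on k S f" "times_differentiable_on k S g"
    using Suc.prems times_differentiable_on_Suc_imp by blast+
  have deriv: "times_differentiable_on k S (\<lambda>x. frechet_derivative f (at x) v)"
    "times_differentiable_on k S (\<lambda>x. frechet_derivative g (at x) v)" for v
    using Suc.prems by simp_all
  have "times_differentiable_on k S (\<lambda>x. frechet_derivative (\<lambda>x. b (f x) (g x)) (at x) v)" for v
  proof (rule times_differentiable_on_cong[OF \<open>open S\<close> _ times_differentiable_on_add[OF \<open>open S\<close>]])
    show "times_differentiable_on k S (\<lambda>x. b (f x) (frechet_derivative g (at x) v))"
      "times_differentiable_on k S (\<lambda>x. b (frechet_derivative f (at x) v) (g x))"
      using Suc.IH lower deriv by blast+
  qed (simp add: frechet_derivative_at[OF *, symmetric])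
  then show ?case using * by (auto simp: differentiable_def)
qed

lemma times_differentiable_on_inverse:
  fixes f :: "'a::euclidean_space \<Rightarrow> real"
  assumes "open S" "\<And>x. x \<in> S \<Longrightarrow> f x \<noteq> 0" "times_differentiable_on k S f"
  shows "times_differentiable_on k S (\<lambda>x. inverse (f x))"
  using assms(3)
proof (induction k)
  case 0
  then show ?case using assms(2) by (simp add: continuous_on_inverse)
next
  case (Suc k)
  have *: "((\<lambda>x. inverse (f x)) has_derivative
      (\<lambda>v. - (inverse (f x) * frechet_derivative f (at x) v * inverse (f x)))) (at x)"
    if "x \<in> S" for x
    by (rule Deriv.has_derivative_inverse)
      (use Suc.prems that assms(2) in \<open>auto simp: frechet_derivative_works\<close>)
  have inv: "times_differentiable_on k S (\<lambda>x. inverse (f x))"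
    using Suc times_differentiable_on_Suc_imp by blast
  have "times_differentiable_on k S (\<lambda>x. frechet_derivative (\<lambda>x. inverse (f x)) (at x) v)" for v
  proof (rule times_differentiable_on_cong[OF \<open>open S\<close>])
    show "times_differentiable_on k S
        (\<lambda>x. - (inverse (f x) * frechet_derivative f (at x) v * inverse (f x)))"
      by (intro times_differentiable_on_bounded_linear[OF bounded_linear_minus[OF bounded_linear_ident]]
          times_differentiable_on_bounded_bilinear[OF bounded_bilinear_mult] inv \<open>open S\<close>)
        (use Suc.prems in simp)
  qed (simp add: frechet_derivative_at[OF *, symmetric])
  then show ?case using * by (auto simp: differentiable_def)
qed

lemma times_differentiable_on_const: "times_differentiable_on k S (\<lambda>x. c)"
  by (induction k arbitrary: c) auto

lemma smooth_on_const: "smooth_on S (\<lambda>x. c)"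
  by (simp add: smooth_on_def times_differentiable_on_const)

lemma smooth_on_ident: "smooth_on S (\<lambda>x. x)"
proof -
  have "times_differentiable_on k S (\<lambda>x. x)" for k
    by (cases k) (simp_all add: times_differentiable_on_const)
  then show ?thesis by (simp add: smooth_on_def)
qed

lemma smooth_on_subset: "smooth_on D f \<Longrightarrow> B \<subseteq> D \<Longrightarrow> smooth_on B f"
proof -
  assume f: "smooth_on D f" and B: "B \<subseteq> D"
  have "times_differentiable_on k B g" if "times_differentiable_on k D g" for k and g :: "'a \<Rightarrow> 'b"
    using that B by (induction k arbitrary: g) (auto intro: continuous_on_subset)
  then show ?thesis using f by (simp add: smooth_on_def)
qed

lemma smooth_on_cong:
  "open S \<Longrightarrow> (\<And>x. x \<in> S \<Longrightarrow> f x = g x) \<Longrightarrow> smooth_on S f \<Longrightarrow> smooth_on S g"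
  unfolding smooth_on_def using times_differentiable_on_cong by blast

lemma smooth_on_add:
  "open S \<Longrightarrow> smooth_on S f \<Longrightarrow> smooth_on S g \<Longrightarrow> smooth_on S (\<lambda>x. f x + g x)"
  unfolding smooth_on_def using times_differentiable_on_add by blast

lemma smooth_on_bounded_linear:
  "bounded_linear l \<Longrightarrow> open S \<Longrightarrow> smooth_on S f \<Longrightarrow> smooth_on S (\<lambda>x. l (f x))"
  unfolding smooth_on_def using times_differentiable_on_bounded_linear by blast

lemma smooth_on_bounded_bilinear:
  "bounded_bilinear b \<Longrightarrow> open S \<Longrightarrow> smooth_on S f \<Longrightarrow> smooth_on S g \<Longrightarrow>
    smooth_on S (\<lambda>x. b (f x) (g x))"
  unfolding smooth_on_def using times_differentiable_on_bounded_bilinear by blast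

lemmas smooth_on_mult = smooth_on_bounded_bilinear[OF bounded_bilinear_mult]
lemmas smooth_on_scaleR = smooth_on_bounded_bilinear[OF bounded_bilinear_scaleR]

lemma smooth_on_divide:
  fixes f g :: "'a::euclidean_space \<Rightarrow> real"
  assumes "open S" "smooth_on S f" "smooth_on S g" "\<And>x. x \<in> S \<Longrightarrow> g x \<noteq> 0"
  shows "smooth_on S (\<lambda>x. f x / g x)"
proof -
  have "smooth_on S (\<lambda>x. inverse (g x))"
    using assms times_differentiable_on_inverse unfolding smooth_on_def by blast
  then show ?thesis using assms by (simp add: divide_inverse smooth_on_mult)
qed

lemma smooth_on_sum:
  "open S \<Longrightarrow> (\<And>i. i \<in> I \<Longrightarrow> smooth_on S (f i)) \<Longrightarrow> smooth_on S (\<lambda>x. \<Sum>i\<in>I. f i x)"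
  by (induction I rule: infinite_finite_induct) (auto intro: smooth_on_const smooth_on_add)

text \<open>A pair is the sum of its images under the two linear inclusions, so that closure under sums and
  bounded linear maps suffices.\<close>

lemma smooth_on_Pair:
  assumes "open S" "smooth_on S f" "smooth_on S g"
  shows "smooth_on S (\<lambda>x. (f x, g x))"
proof -
  have "bounded_linear (\<lambda>a::'b. (a, 0::'c))" "bounded_linear (\<lambda>a::'c. (0::'b, a))"
    by (intro bounded_linear_Pair bounded_linear_ident bounded_linear_zero)+
  then have "smooth_on S (\<lambda>x. (f x, 0) + (0, g x))"
    using assms by (intro smooth_on_add) (auto intro: smooth_on_bounded_linear)
  then show ?thesis by simp
qed

lemma smooth_on_imp_differentiable: "smooth_on S f \<Longrightarrow> x \<in> S \<Longrightarrow> f differentiable (at x)"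
  unfolding smooth_on_def by (metis times_differentiable_on.simps(2))

lemma smooth_on_frechet_derivative:
  "smooth_on S f \<Longrightarrow> smooth_on S (\<lambda>x. frechet_derivative f (at x) v)"
  unfolding smooth_on_def by (metis times_differentiable_on.simps(2))

lemma smooth_on_imp_continuous_on: "smooth_on S f \<Longrightarrow> continuous_on S f"
  unfolding smooth_on_def by (metis times_differentiable_on.simps(1))

lemma has_frechet_derivative_smooth_on:
  "smooth_on S f \<Longrightarrow> x \<in> S \<Longrightarrow> (f has_derivative frechet_derivative f (at x)) (at x)"
  using frechet_derivative_works smooth_on_imp_differentiable by blast

lemma frechet_derivative_open_cong:
  assumes "open S" "x \<in> S" "\<And>w. w \<in> S \<Longrightarrow> f w = g w"
  shows "frechet_derivative f (at x) = frechet_derivative g (at x)"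
proof -
  have "(f has_derivative D) (at x) \<longleftrightarrow> (g has_derivative D) (at x)" for D
    using assms has_derivative_transform_within_open[OF _ assms(1,2), of f D UNIV g]
      has_derivative_transform_within_open[OF _ assms(1,2), of g D UNIV f] by auto
  then show ?thesis unfolding frechet_derivative_def by simp
qed

text \<open>Two applications of the mean value theorem: first in the direction \<open>v\<close> to the difference of \<open>f\<close>
  in the direction \<open>w\<close>, then in the direction \<open>w\<close>. The left-hand side is symmetric in \<open>v\<close> and \<open>w\<close>,
  the right-hand side is not; this is the source of the symmetry of second derivatives.\<close>

lemma second_difference_eq_mixed_derivative:
  fixes f :: "'a::euclidean_space \<Rightarrow> real"
  assumes f: "smooth_on S f" and "h > 0"
    and S: "\<And>s t. s \<in> {0..h} \<Longrightarrow> t \<in> {0..h} \<Longrightarrow> z + s *\<^sub>R v + t *\<^sub>R w \<in> S"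
  shows "\<exists>s\<in>{0..h}. \<exists>t\<in>{0..h}.
    f (z + h *\<^sub>R v + h *\<^sub>R w) - f (z + h *\<^sub>R v) - f (z + h *\<^sub>R w) + f z =
    h\<^sup>2 * frechet_derivative (\<lambda>x. frechet_derivative f (at x) v) (at (z + s *\<^sub>R v + t *\<^sub>R w)) w"
proof -
  let ?f' = "\<lambda>x. frechet_derivative f (at x)"
  let ?f'' = "\<lambda>x. frechet_derivative (\<lambda>x. ?f' x v) (at x)"
  have scale: "frechet_derivative g (at x) (c *\<^sub>R u) = c * frechet_derivative g (at x) u"
    if "smooth_on S g" "x \<in> S" for g :: "'a \<Rightarrow> real" and x c u
    using linear_frechet_derivative[OF smooth_on_imp_differentiable[OF that]]
    by (simp add: linear_cmul)
  have line: "((\<lambda>s. g (p + s *\<^sub>R u)) has_derivative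
      (\<lambda>s. frechet_derivative g (at (p + r *\<^sub>R u)) (s *\<^sub>R u))) (at r within R)"
    if "smooth_on S g" "p + r *\<^sub>R u \<in> S" for g :: "'a \<Rightarrow> real" and p u r R
    by (rule has_derivative_compose[of "\<lambda>s. p + s *\<^sub>R u" _ _ _ g])
      (use that has_frechet_derivative_smooth_on in \<open>auto intro!: derivative_eq_intros\<close>)
  have S0: "z + s *\<^sub>R v \<in> S" if "s \<in> {0..h}" for s using S[OF that, of 0] \<open>h > 0\<close> by simp
  have Sh: "z + h *\<^sub>R w + s *\<^sub>R v \<in> S" if "s \<in> {0..h}" for s
    using S[OF that, of h] \<open>h > 0\<close> by (simp add: add_ac)
  have "\<exists>s\<in>{0..h}. (f (z + h *\<^sub>R w + h *\<^sub>R v) - f (z + h *\<^sub>R v)) -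
      (f (z + h *\<^sub>R w + 0 *\<^sub>R v) - f (z + 0 *\<^sub>R v)) =
      ?f' (z + h *\<^sub>R w + s *\<^sub>R v) ((h - 0) *\<^sub>R v) - ?f' (z + s *\<^sub>R v) ((h - 0) *\<^sub>R v)"
    by (rule mvt_very_simple[OF less_imp_le[OF \<open>h > 0\<close>],
          of "\<lambda>s. f (z + h *\<^sub>R w + s *\<^sub>R v) - f (z + s *\<^sub>R v)"
            "\<lambda>s r. ?f' (z + h *\<^sub>R w + s *\<^sub>R v) (r *\<^sub>R v) - ?f' (z + s *\<^sub>R v) (r *\<^sub>R v)"])
      (use Sh S0 in \<open>auto intro!: has_derivative_diff line[OF f]\<close>)
  then obtain s where s: "s \<in> {0..h}"
    and 1: "f (z + h *\<^sub>R v + h *\<^sub>R w) - f (z + h *\<^sub>R v) - f (z + h *\<^sub>R w) + f z =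
      h * (?f' (z + s *\<^sub>R v + h *\<^sub>R w) v - ?f' (z + s *\<^sub>R v) v)"
    using Sh S0 \<open>h > 0\<close> by (fastforce simp: scale[OF f] algebra_simps)
  have "\<exists>t\<in>{0..h}. ?f' (z + s *\<^sub>R v + h *\<^sub>R w) v - ?f' (z + s *\<^sub>R v + 0 *\<^sub>R w) v =
      ?f'' (z + s *\<^sub>R v + t *\<^sub>R w) ((h - 0) *\<^sub>R w)"
    by (rule mvt_very_simple[OF less_imp_le[OF \<open>h > 0\<close>]])
      (use S[OF s] line[OF smooth_on_frechet_derivative[OF f]] in auto)
  then obtain t where t: "t \<in> {0..h}"
    and 2: "?f' (z + s *\<^sub>R v + h *\<^sub>R w) v - ?f' (z + s *\<^sub>R v) v = h * ?f'' (z + s *\<^sub>R v + t *\<^sub>R w) w"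
    using S[OF s] by (auto simp: scale[OF smooth_on_frechet_derivative[OF f]])
  have "f (z + h *\<^sub>R v + h *\<^sub>R w) - f (z + h *\<^sub>R v) - f (z + h *\<^sub>R w) + f z =
      h\<^sup>2 * ?f'' (z + s *\<^sub>R v + t *\<^sub>R w) w"
    unfolding 1 2 by (simp add: power2_eq_square)
  then show ?thesis using s t by blast
qed

text \<open>Schwarz's theorem. Both mixed derivatives are limits of the same second difference quotient
  over parallelograms that shrink to \<open>z\<close>.\<close>

lemma mixed_derivatives_commute:
  fixes f :: "'a::euclidean_space \<Rightarrow> real"
  assumes "open S" "smooth_on S f" "z \<in> S"
  shows "frechet_derivative (\<lambda>x. frechet_derivative f (at x) v) (at z) w =
    frechet_derivative (\<lambda>x. frechet_derivative f (at x) w) (at z) v" (is "?a z = ?b z")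
proof (rule ccontr)
  assume "?a z \<noteq> ?b z"
  \<comment> \<open>The intervals of radius \<open>e\<close> around the two values are disjoint.\<close>
  define e where "e = \<bar>?a z - ?b z\<bar> / 2"
  have e: "e > 0" using \<open>?a z \<noteq> ?b z\<close> by (simp add: e_def)
  have cont: "isCont (\<lambda>x. frechet_derivative (\<lambda>x. frechet_derivative f (at x) v) (at x) w) z"
    for v w
    using assms smooth_on_imp_continuous_on[OF smooth_on_frechet_derivative[OF
        smooth_on_frechet_derivative[OF assms(2)]]] continuous_on_eq_continuous_at by blast
  obtain d1 where d1: "d1 > 0" "\<And>x. dist x z < d1 \<Longrightarrow> \<bar>?a x - ?a z\<bar> < e"
    using cont[unfolded continuous_at_eps_delta] e by (metis dist_real_def)
  obtain d2 where d2: "d2 > 0" "\<And>x. dist x z < d2 \<Longrightarrow> \<bar>?b x - ?b z\<bar> < e"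
    using cont[unfolded continuous_at_eps_delta] e by (metis dist_real_def)
  obtain d3 where d3: "d3 > 0" "ball z d3 \<subseteq> S" using assms openE by blast
  define d where "d = min d1 (min d2 d3)"
  \<comment> \<open>The summand 1 keeps \<open>l\<close> positive even if both directions vanish.\<close>
  define l where "l = norm v + norm w + 1"
  define h where "h = d / (2 * l)"
  have pos: "l > 0" by (simp add: l_def add_nonneg_pos)
  have "d > 0" using d1 d2 d3 by (simp add: d_def)
  then have h: "h > 0" using pos by (simp add: h_def)
  have near: "dist (z + s *\<^sub>R v + t *\<^sub>R w) z < d" if "s \<in> {0..h}" "t \<in> {0..h}" for s t
  proof -
    have "dist (z + s *\<^sub>R v + t *\<^sub>R w) z = norm (s *\<^sub>R v + t *\<^sub>R w)"
      by (simp add: dist_norm add.assoc)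
    also have "\<dots> \<le> s * norm v + t * norm w"
      using that by (intro order_trans[OF norm_triangle_ineq]) simp
    also have "\<dots> \<le> h * norm v + h * norm w"
      using that by (intro add_mono mult_right_mono) auto
    also have "\<dots> \<le> h * l" using h by (simp add: l_def algebra_simps)
    also have "\<dots> = d / 2" using pos by (simp add: h_def)
    finally show ?thesis using \<open>d > 0\<close> by simp
  qed
  then have S: "z + s *\<^sub>R v + t *\<^sub>R w \<in> S" "z + s *\<^sub>R w + t *\<^sub>R v \<in> S"
    if "s \<in> {0..h}" "t \<in> {0..h}" for s t
    using that d3(2) near[OF that] near[OF that(2,1)]
    by (force simp: d_def dist_commute add_ac)+
  obtain s t where st: "s \<in> {0..h}" "t \<in> {0..h}"
    "f (z + h *\<^sub>R v + h *\<^sub>R w) - f (z + h *\<^sub>R v) - f (z + h *\<^sub>R w) + f z =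
      h\<^sup>2 * ?a (z + s *\<^sub>R v + t *\<^sub>R w)"
    using second_difference_eq_mixed_derivative[OF assms(2) h S(1)] by blast
  obtain s' t' where st': "s' \<in> {0..h}" "t' \<in> {0..h}"
    "f (z + h *\<^sub>R w + h *\<^sub>R v) - f (z + h *\<^sub>R w) - f (z + h *\<^sub>R v) + f z =
      h\<^sup>2 * ?b (z + s' *\<^sub>R w + t' *\<^sub>R v)"
    using second_difference_eq_mixed_derivative[OF assms(2) h S(2)] by blast
  have "h\<^sup>2 * ?a (z + s *\<^sub>R v + t *\<^sub>R w) = h\<^sup>2 * ?b (z + s' *\<^sub>R w + t' *\<^sub>R v)"
    unfolding st(3)[symmetric] st'(3)[symmetric] by (simp add: algebra_simps)
  then have "?a (z + s *\<^sub>R v + t *\<^sub>R w) = ?b (z + s' *\<^sub>R w + t' *\<^sub>R v)" using h by simp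
  moreover have "\<bar>?a (z + s *\<^sub>R v + t *\<^sub>R w) - ?a z\<bar> < e"
    using near[OF st(1,2)] d1 by (simp add: d_def)
  moreover have "\<bar>?b (z + s' *\<^sub>R w + t' *\<^sub>R v) - ?b z\<bar> < e"
    using near[OF st'(2,1)] d2 by (simp add: d_def add_ac)
  ultimately have "\<bar>?a z - ?b z\<bar> < 2 * e" by linarith
  then show False by (simp add: e_def)
qed


section \<open>Derivatives along vector fields\<close>

text \<open>The action \<open>X f\<close> of a vector field \<open>X\<close> as a derivation on functions.\<close>

definition along :: "('a \<Rightarrow> 'a) \<Rightarrow> ('a::euclidean_space \<Rightarrow> real) \<Rightarrow> 'a \<Rightarrow> real" where
  "along X f z = frechet_derivative f (at z) (X z)"

lemma frechet_derivative_eq_sum_Basis: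
  assumes "f differentiable (at z)"
  shows "frechet_derivative f (at z) v = (\<Sum>b\<in>Basis. (v \<bullet> b) * (frechet_derivative f (at z) b :: real))"
  using Linear_Algebra.linear_componentwise[OF linear_frechet_derivative[OF assms], of v "1::real"] by simp

lemma frechet_derivative_mult:
  fixes f g :: "'a::euclidean_space \<Rightarrow> real"
  assumes "f differentiable (at z)" "g differentiable (at z)"
  shows "frechet_derivative (\<lambda>w. f w * g w) (at z) v =
    f z * frechet_derivative g (at z) v + frechet_derivative f (at z) v * g z"
  by (subst frechet_derivative_at[OF has_derivative_mult, symmetric])
    (use assms in \<open>auto simp: frechet_derivative_works\<close>)

lemma frechet_derivative_add:
  fixes f g :: "'a::euclidean_space \<Rightarrow> real"
  assumes "f differentiable (at z)" "g differentiable (at z)"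
  shows "frechet_derivative (\<lambda>w. f w + g w) (at z) v =
    frechet_derivative f (at z) v + frechet_derivative g (at z) v"
  by (subst frechet_derivative_at[OF has_derivative_add, symmetric])
    (use assms in \<open>auto simp: frechet_derivative_works\<close>)

lemma frechet_derivative_sum:
  fixes f :: "'i \<Rightarrow> 'a::euclidean_space \<Rightarrow> real"
  assumes "\<And>i. i \<in> I \<Longrightarrow> f i differentiable (at z)"
  shows "frechet_derivative (\<lambda>w. \<Sum>i\<in>I. f i w) (at z) v =
    (\<Sum>i\<in>I. frechet_derivative (f i) (at z) v)"
  by (subst frechet_derivative_at[OF has_derivative_sum, symmetric])
    (use assms in \<open>auto simp: frechet_derivative_works\<close>)

lemma frechet_derivative_cmult:
  fixes f :: "'a::euclidean_space \<Rightarrow> real"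
  assumes "f differentiable (at z)"
  shows "frechet_derivative (\<lambda>w. c * f w) (at z) v = c * frechet_derivative f (at z) v"
  by (subst frechet_derivative_mult) (use assms in auto)

lemma frechet_derivative_bounded_linear:
  assumes "bounded_linear l" "f differentiable (at z)"
  shows "frechet_derivative (\<lambda>w. l (f w)) (at z) v = l (frechet_derivative f (at z) v)"
  by (subst frechet_derivative_at[OF bounded_linear.has_derivative, symmetric, OF assms(1)])
    (use assms in \<open>auto simp: frechet_derivative_works\<close>)

lemma smooth_on_along:
  fixes f :: "'a::euclidean_space \<Rightarrow> real"
  assumes "open S" "smooth_on S f" "smooth_on S X"
  shows "smooth_on S (along X f)"
proof (rule smooth_on_cong[OF \<open>open S\<close>])
  show "smooth_on S (\<lambda>w. \<Sum>b\<in>Basis. (X w \<bullet> b) * frechet_derivative f (at w) b)"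
    by (intro smooth_on_sum smooth_on_mult smooth_on_frechet_derivative assms
        smooth_on_bounded_linear[OF bounded_linear_inner_left])
qed (simp add: along_def frechet_derivative_eq_sum_Basis[symmetric]
    smooth_on_imp_differentiable[OF assms(2)])

text \<open>This is the commutator identity \<open>[\<partial>\<^sub>v, X] f = (\<partial>\<^sub>v X) f\<close> for a constant vector \<open>v\<close>. Applied to the
  geodesic field and the Liouville field it replaces all index manipulations with second
  derivatives.\<close>

lemma frechet_derivative_along:
  fixes f :: "'a::euclidean_space \<Rightarrow> real"
  assumes "open S" "smooth_on S f" "z \<in> S" and X: "X differentiable (at z)"
  shows "frechet_derivative (along X f) (at z) v =
    along X (\<lambda>w. frechet_derivative f (at w) v) z +
    frechet_derivative f (at z) (frechet_derivative X (at z) v)"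
proof -
  let ?f' = "\<lambda>w. frechet_derivative f (at w)"
  note diff = smooth_on_imp_differentiable[OF assms(2)]
  note diff' = smooth_on_imp_differentiable[OF smooth_on_frechet_derivative[OF assms(2)] \<open>z \<in> S\<close>]
  have Xb: "(\<lambda>w. X w \<bullet> b) differentiable (at z)" for b using X by simp
  have "frechet_derivative (along X f) (at z) v =
      frechet_derivative (\<lambda>w. \<Sum>b\<in>Basis. (X w \<bullet> b) * ?f' w b) (at z) v"
    by (intro fun_cong[OF frechet_derivative_open_cong[OF assms(1,3)]])
      (simp add: along_def frechet_derivative_eq_sum_Basis[symmetric] diff)
  also have "\<dots> = (\<Sum>b\<in>Basis. (X z \<bullet> b) * frechet_derivative (\<lambda>w. ?f' w b) (at z) v +
      (frechet_derivative X (at z) v \<bullet> b) * ?f' z b)"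
    by (simp add: frechet_derivative_sum frechet_derivative_mult Xb diff' differentiable_mult
        frechet_derivative_bounded_linear[OF bounded_linear_inner_left X])
  also have "\<dots> = (\<Sum>b\<in>Basis. (X z \<bullet> b) * frechet_derivative (\<lambda>w. ?f' w v) (at z) b) +
      (\<Sum>b\<in>Basis. (frechet_derivative X (at z) v \<bullet> b) * ?f' z b)"
    by (simp add: sum.distrib mixed_derivatives_commute[OF assms(1-3)])
  also have "\<dots> = along X (\<lambda>w. ?f' w v) z + ?f' z (frechet_derivative X (at z) v)"
    by (simp add: along_def frechet_derivative_eq_sum_Basis[symmetric] diff' diff[OF \<open>z \<in> S\<close>])
  finally show ?thesis .
qed


section \<open>Homogeneity and the geodesic field in coordinates\<close>

text \<open>The generator \<open>y\<^sup>i \<partial>/\<partial>y\<^sup>i\<close> of the dilations of the fibres, and the spray as a vector field.\<close>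

definition liouville_field :: "'n::finite xy \<Rightarrow> 'n xy" where
  "liouville_field z = (0, snd z)"

definition geodesic_field :: "'n::finite sprayc \<Rightarrow> 'n xy \<Rightarrow> 'n xy" where
  "geodesic_field G z = (snd z, - 2 *\<^sub>R G z)"

lemma pdx_eq: "pdx k f = (\<lambda>z. frechet_derivative f (at z) (axis k 1, 0))"
  and pdy_eq: "pdy k f = (\<lambda>z. frechet_derivative f (at z) (0, axis k 1))"
  by (simp_all add: fun_eq_iff pdx_def pdy_def)

lemma smooth_on_pdy: "smooth_on D f \<Longrightarrow> smooth_on D (pdy k f)"
  by (simp add: pdy_eq smooth_on_frechet_derivative)

lemma smooth_on_coef: "open D \<Longrightarrow> smooth_on D G \<Longrightarrow> smooth_on D (coef G i)"
  unfolding coef_def[abs_def] by (intro smooth_on_bounded_linear[OF bounded_linear_vec_nth])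

lemma smooth_on_snd: "open D \<Longrightarrow> smooth_on D snd"
  using smooth_on_bounded_linear[OF bounded_linear_snd _ smooth_on_ident] .

lemma smooth_on_fibre_coordinate: "open D \<Longrightarrow> smooth_on D (\<lambda>z. snd z $ k)"
  by (intro smooth_on_bounded_linear[OF bounded_linear_vec_nth] smooth_on_snd)

lemma frechet_derivative_fibre_coordinate:
  "frechet_derivative (\<lambda>z. snd z $ k) (at z) v = snd v $ k"
  by (subst frechet_derivative_at[symmetric, of _ "\<lambda>v. snd v $ k"])
    (auto intro!: bounded_linear_imp_has_derivative
      bounded_linear_compose[OF bounded_linear_vec_nth bounded_linear_snd])

lemma sum_axis: "(\<Sum>k\<in>UNIV. axis i (1::real) $ k * f k) = f i"
  by (simp add: axis_def if_distrib[where f="\<lambda>x. x * _"] cong: if_cong)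

lemma frechet_derivative_eq_sum_partials:
  fixes f :: "'n::finite xy \<Rightarrow> real"
  assumes "f differentiable (at z)"
  shows "frechet_derivative f (at z) (a, b) =
    (\<Sum>k\<in>UNIV. a $ k * pdx k f z) + (\<Sum>k\<in>UNIV. b $ k * pdy k f z)"
proof -
  interpret linear "frechet_derivative f (at z)" by (rule linear_frechet_derivative[OF assms])
  have expand: "v = (\<Sum>k\<in>UNIV. v $ k *\<^sub>R axis k 1)" for v :: "real ^ 'n"
    using basis_expansion[of v] by (simp add: scalar_mult_eq_scaleR)
  have "(a, b) = (\<Sum>k\<in>UNIV. a $ k *\<^sub>R (axis k 1, 0)) + (\<Sum>k\<in>UNIV. b $ k *\<^sub>R (0, axis k 1))"
    by (rule prod_eqI) (simp_all add: fst_sum snd_sum expand[symmetric])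
  then show ?thesis by (simp only: add sum scale pdx_def pdy_def real_scaleR_def)
qed

lemma along_geodesic_field:
  assumes "f differentiable (at z)"
  shows "along (geodesic_field G) f z =
    (\<Sum>k\<in>UNIV. snd z $ k * pdx k f z) - 2 * (\<Sum>k\<in>UNIV. coef G k z * pdy k f z)"
  unfolding along_def geodesic_field_def frechet_derivative_eq_sum_partials[OF assms]
  by (simp add: coef_def sum_distrib_left sum_negf mult.assoc)

lemma along_liouville_field:
  assumes "f differentiable (at z)"
  shows "along liouville_field f z = (\<Sum>k\<in>UNIV. snd z $ k * pdy k f z)"
  unfolding along_def liouville_field_def frechet_derivative_eq_sum_partials[OF assms]
  by simp

text \<open>Euler's theorem. Only the values of \<open>f\<close> near \<open>z\<close> on the ray through \<open>z\<close> enter: both sides are the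
  derivative of \<open>t \<mapsto> f (x, t y)\<close> at \<open>t = 1\<close>.\<close>

lemma euler_homogeneous:
  fixes f :: "'n::finite xy \<Rightarrow> real"
  assumes "pos_homogeneous m D f" "z \<in> D" "f differentiable (at z)"
  shows "along liouville_field f z = real m * f z"
proof -
  obtain x y where z: "z = (x, y)" by (cases z)
  have "((\<lambda>t. f (x, t *\<^sub>R y)) has_derivative (\<lambda>t. frechet_derivative f (at z) (0, t *\<^sub>R y))) (at 1)"
    by (rule has_derivative_compose[of "\<lambda>t. (x, t *\<^sub>R y)" _ _ _ f])
      (use assms(3) in \<open>auto simp: z frechet_derivative_works intro!: derivative_eq_intros\<close>)
  moreover have "((\<lambda>t. f (x, t *\<^sub>R y)) has_derivative (\<lambda>t. t * (real m * f z))) (at 1)"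
  proof (rule has_derivative_transform_within_open[of "\<lambda>t. t ^ m * f z" _ _ _ "{0<..}"])
    show "((\<lambda>t. t ^ m * f z) has_derivative (\<lambda>t. t * (real m * f z))) (at 1)"
      by (auto intro!: derivative_eq_intros simp: mult_ac)
  qed (use assms(1,2) in \<open>auto simp: z pos_homogeneous_def\<close>)
  ultimately have "(\<lambda>t. frechet_derivative f (at z) (0, t *\<^sub>R y)) = (\<lambda>t. t * (real m * f z))"
    by (rule has_derivative_unique)
  from fun_cong[OF this, of 1] show ?thesis by (simp add: along_def liouville_field_def z)
qed

text \<open>Together with Euler's theorem this shows that vertical derivatives lower the degree of
  homogeneity by one.\<close>

lemma pdy_along_liouville_field:
  assumes "open D" "smooth_on D f" "z \<in> D"
  shows "pdy k (along liouville_field f) z = along liouville_field (pdy k f) z + pdy k f z"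
proof -
  have l: "bounded_linear (\<lambda>v::'n xy. (0::real ^ 'n, snd v))"
    by (intro bounded_linear_Pair bounded_linear_zero bounded_linear_snd)
  then have d: "(liouville_field has_derivative (\<lambda>v. (0, snd v))) (at z)"
    unfolding liouville_field_def[abs_def] by (rule bounded_linear_imp_has_derivative)
  then have "liouville_field differentiable (at z)" by (auto simp: differentiable_def)
  then show ?thesis
    unfolding pdy_eq by (subst frechet_derivative_along[OF assms])
      (simp_all add: frechet_derivative_at[OF d, symmetric])
qed

text \<open>The commutators of the spray with the coordinate derivatives. The term \<open>\<partial>\<^sub>k f\<close> in the vertical one
  arises because the base component \<open>y\<close> of the geodesic field depends on \<open>y\<close>.\<close>

lemma
  assumes "open D" "smooth_on D f" "z \<in> D" and G: "G differentiable (at z)"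
  shows pdx_along_geodesic_field: "pdx k (along (geodesic_field G) f) z =
      along (geodesic_field G) (pdx k f) z - 2 * (\<Sum>j\<in>UNIV. pdx k (coef G j) z * pdy j f z)"
    and pdy_along_geodesic_field: "pdy k (along (geodesic_field G) f) z =
      along (geodesic_field G) (pdy k f) z + pdx k f z
      - 2 * (\<Sum>j\<in>UNIV. pdy k (coef G j) z * pdy j f z)"
proof -
  let ?G' = "frechet_derivative G (at z)"
  have "(G has_derivative ?G') (at z)" using G by (simp add: frechet_derivative_works)
  then have d: "(geodesic_field G has_derivative (\<lambda>v. (snd v, - 2 *\<^sub>R ?G' v))) (at z)"
    unfolding geodesic_field_def[abs_def]
    by (intro has_derivative_Pair bounded_linear_imp_has_derivative[OF bounded_linear_snd]
        has_derivative_scaleR_right)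
  then have d': "geodesic_field G differentiable (at z)" by (auto simp: differentiable_def)
  have f: "f differentiable (at z)" using smooth_on_imp_differentiable assms(2,3) .
  have coef: "frechet_derivative (coef G j) (at z) v = ?G' v $ j" for j v
    unfolding coef_def[abs_def]
    by (rule frechet_derivative_bounded_linear[OF bounded_linear_vec_nth G])
  have *: "frechet_derivative (along (geodesic_field G) f) (at z) v =
      along (geodesic_field G) (\<lambda>w. frechet_derivative f (at w) v) z +
      (\<Sum>j\<in>UNIV. snd v $ j * pdx j f z)
      - 2 * (\<Sum>j\<in>UNIV. frechet_derivative (coef G j) (at z) v * pdy j f z)" for v
    unfolding frechet_derivative_along[OF assms(1-3) d'] frechet_derivative_at[OF d, symmetric]
      frechet_derivative_eq_sum_partials[OF f] coef
    by (simp add: sum_distrib_left sum_negf mult.assoc)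
  show "pdx k (along (geodesic_field G) f) z =
      along (geodesic_field G) (pdx k f) z - 2 * (\<Sum>j\<in>UNIV. pdx k (coef G j) z * pdy j f z)"
    unfolding pdx_def[of k "along _ f"] * by (simp add: pdx_eq)
  show "pdy k (along (geodesic_field G) f) z =
      along (geodesic_field G) (pdy k f) z + pdx k f z
      - 2 * (\<Sum>j\<in>UNIV. pdy k (coef G j) z * pdy j f z)"
    unfolding pdy_def[of k "along _ f"] * by (simp add: pdy_eq sum_axis)
qed

lemma smooth_on_geodesic_field:
  assumes "open D" "smooth_on D G"
  shows "smooth_on D (geodesic_field G)"
  unfolding geodesic_field_def[abs_def]
  by (intro smooth_on_Pair smooth_on_snd smooth_on_scaleR smooth_on_const assms)

lemma along_open_cong:
  assumes "open S" "z \<in> S" "\<And>w. w \<in> S \<Longrightarrow> f w = g w"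
  shows "along X f z = along X g z"
  unfolding along_def using frechet_derivative_open_cong[OF assms] by simp

lemma pdx_open_cong:
  assumes "open D" "z \<in> D" "\<And>w. w \<in> D \<Longrightarrow> f w = g w"
  shows "pdx k f z = pdx k g z"
  unfolding pdx_def using frechet_derivative_open_cong[OF assms] by simp

lemma pdy_open_cong:
  assumes "open D" "z \<in> D" "\<And>w. w \<in> D \<Longrightarrow> f w = g w"
  shows "pdy k f z = pdy k g z"
  unfolding pdy_def using frechet_derivative_open_cong[OF assms] by simp

text \<open>The constant relation between the two functions is needed on a neighbourhood, since the
  fundamental tensor is built from second derivatives.\<close>

lemma fundamental_tensor_cmult:
  assumes "open B" "z \<in> B" "smooth_on B M" "\<And>w. w \<in> B \<Longrightarrow> L w = a * M w"
  shows "fundamental_tensor L z = a *\<^sub>R fundamental_tensor M z"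
proof -
  let ?M = "\<lambda>w. M w / 2"
  have M: "smooth_on B ?M"
    using assms by (intro smooth_on_divide smooth_on_const) auto
  note diff = smooth_on_imp_differentiable
  have 1: "pdy i (\<lambda>w. L w / 2) w = a * pdy i ?M w" if w: "w \<in> B" for i w
  proof -
    have "pdy i (\<lambda>w. L w / 2) w = pdy i (\<lambda>w. a * ?M w) w"
      by (rule pdy_open_cong[OF assms(1) w]) (simp add: assms(4))
    then show ?thesis unfolding pdy_def frechet_derivative_cmult[OF diff[OF M w]] .
  qed
  have "pdy j (pdy i (\<lambda>w. L w / 2)) z = a * pdy j (pdy i ?M) z" for i j
  proof -
    have "pdy j (pdy i (\<lambda>w. L w / 2)) z = pdy j (\<lambda>w. a * pdy i ?M w) z"
      by (rule pdy_open_cong[OF assms(1,2) 1])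
    then show ?thesis
      unfolding pdy_def[of j] frechet_derivative_cmult[OF diff[OF smooth_on_pdy[OF M] assms(2)]] .
  qed
  then show ?thesis by (simp add: fundamental_tensor_def vec_eq_iff)
qed

text \<open>Multiplying the definition of the spray of a metric by \<open>4 g\<^sub>l\<^sub>i\<close> removes the inverse matrix, and
  what remains is the Euler-Lagrange equation of \<open>L\<close> along the integral curves of \<open>G\<close>.\<close>

lemma along_geodesic_euler_lagrange:
  fixes L :: "'n::finite xy \<Rightarrow> real"
  assumes "open D" "smooth_on D L" "z \<in> D" and inv: "invertible (fundamental_tensor L z)"
  shows "G z = metric_spray L z \<longleftrightarrow>
    (\<forall>l. along (geodesic_field G) (pdy l L) z = pdx l L z)"
proof -
  let ?g = "fundamental_tensor L z"
  define E where "E = (\<chi> l. (\<Sum>k\<in>UNIV. pdy l (pdx k L) z * snd z $ k) - pdx l L z)"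
  have "?g ** matrix_inv ?g = mat 1 \<and> matrix_inv ?g ** ?g = mat 1"
    using inv unfolding invertible_def matrix_inv_def by (rule someI_ex)
  then have solve: "matrix_inv ?g *v u = w \<longleftrightarrow> u = ?g *v w" for u w
    by (metis matrix_vector_mul_assoc matrix_vector_mul_lid)
  have "pdy i (\<lambda>w. L w / 2) w = (1/2) * pdy i L w" if "w \<in> D" for i w
    using frechet_derivative_cmult[of L w "1/2"] smooth_on_imp_differentiable[OF assms(2) that]
    by (simp add: pdy_def)
  then have "pdy j (pdy i (\<lambda>w. L w / 2)) z = pdy j (\<lambda>w. (1/2) * pdy i L w) z" for i j
    unfolding pdy_def[of j] by (intro fun_cong[OF frechet_derivative_open_cong[OF assms(1,3)]])
  then have g: "?g $ i $ j = (1/2) * pdy j (pdy i L) z" for i j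
    using frechet_derivative_cmult[of "pdy i L" z "1/2"]
      smooth_on_imp_differentiable[OF smooth_on_pdy[OF assms(2)] assms(3)]
    by (simp add: fundamental_tensor_def pdy_def[of j])
  have E: "along (geodesic_field G) (pdy l L) z - pdx l L z = E $ l - 4 * (?g *v G z) $ l" for l
  proof -
    have "pdy l (pdx k L) z = pdx k (pdy l L) z" for k
      unfolding pdx_eq pdy_eq by (rule mixed_derivatives_commute[OF assms(1-3)])
    then show ?thesis
      using smooth_on_imp_differentiable[OF smooth_on_pdy[OF assms(2)] assms(3)]
      by (simp add: along_geodesic_field E_def matrix_vector_mult_def g coef_def
          sum_distrib_left mult_ac)
  qed
  have "4 *\<^sub>R metric_spray L z = matrix_inv ?g *v E"
    by (simp add: vec_eq_iff metric_spray_def matrix_vector_mult_def E_def)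
  moreover have "G z = metric_spray L z \<longleftrightarrow> 4 *\<^sub>R metric_spray L z = 4 *\<^sub>R G z" by auto
  ultimately have "G z = metric_spray L z \<longleftrightarrow> matrix_inv ?g *v E = 4 *\<^sub>R G z" by simp
  also have "\<dots> \<longleftrightarrow> E = 4 *\<^sub>R (?g *v G z)"
    by (simp add: solve matrix_vector_mult_scaleR)
  also have "\<dots> \<longleftrightarrow> (\<forall>l. along (geodesic_field G) (pdy l L) z - pdx l L z = 0)"
    unfolding E by (simp add: vec_eq_iff)
  finally show ?thesis by simp
qed


section \<open>Functions constant along horizontal curves\<close>

text \<open>The coordinate expression of a spray. Homogeneity enters through Euler's identity only; this form
  is inherited by associated Hamel sprays without looking at scaled points.\<close>

locale local_spray =
  fixes D :: "'n::finite xy set" and G :: "'n sprayc"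
  assumes open_D: "open D"
    and smooth_G: "smooth_on D G"
    and euler_G: "z \<in> D \<Longrightarrow> along liouville_field (coef G r) z = 2 * coef G r z"
begin

abbreviation spray_deriv :: "('n xy \<Rightarrow> real) \<Rightarrow> 'n xy \<Rightarrow> real" where
  "spray_deriv \<equiv> along (geodesic_field G)"

lemmas diff = smooth_on_imp_differentiable

lemma smooth_coef: "smooth_on D (coef G r)"
  by (rule smooth_on_coef[OF open_D smooth_G])

lemma smooth_conn1: "smooth_on D (conn1 G r i)"
  unfolding conn1_def by (rule smooth_on_pdy[OF smooth_coef])

lemma smooth_spray_deriv: "smooth_on D f \<Longrightarrow> smooth_on D (spray_deriv f)"
  by (intro smooth_on_along smooth_on_geodesic_field open_D smooth_G)

lemma sum_conn1:
  assumes "z \<in> D"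
  shows "(\<Sum>j\<in>UNIV. snd z $ j * conn1 G r j z) = 2 * coef G r z"
  using euler_G[OF assms, of r] along_liouville_field[OF diff[OF smooth_coef assms]]
  by (simp add: conn1_def)

text \<open>The coefficients \<open>G\<^sup>r\<^sub>k\<close> are homogeneous of degree one, so this is again Euler's identity.\<close>

lemma sum_conn2:
  assumes z: "z \<in> D"
  shows "(\<Sum>j\<in>UNIV. snd z $ j * conn2 G r k j z) = conn1 G r k z"
proof -
  have "along liouville_field (conn1 G r k) z + conn1 G r k z =
      pdy k (along liouville_field (coef G r)) z"
    unfolding conn1_def by (rule pdy_along_liouville_field[OF open_D smooth_coef z, symmetric])
  also have "\<dots> = pdy k (\<lambda>w. 2 * coef G r w) z"
    by (rule pdy_open_cong[OF open_D z]) (rule euler_G)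
  also have "\<dots> = 2 * conn1 G r k z"
    by (simp add: pdy_def conn1_def frechet_derivative_cmult diff[OF smooth_coef z])
  finally show ?thesis
    using along_liouville_field[OF diff[OF smooth_conn1 z]] by (simp add: conn1_def conn2_def)
qed

text \<open>The formula \<open>f\<^sub>;\<^sub>0 = S f\<close>: contraction of \<open>\<delta>\<^sub>i\<close> with \<open>y\<^sup>i\<close> recovers the spray.\<close>

lemma hderiv0_eq:
  assumes z: "z \<in> D" and f: "f differentiable (at z)"
  shows "hderiv0 G f z = spray_deriv f z"
proof -
  have "hderiv0 G f z = (\<Sum>i\<in>UNIV. snd z $ i * pdx i f z) -
      (\<Sum>i\<in>UNIV. \<Sum>r\<in>UNIV. snd z $ i * conn1 G r i z * pdy r f z)"
    by (simp add: hderiv0_def hderiv_def right_diff_distrib sum_subtractf sum_distrib_left mult_ac)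
  also have "(\<Sum>i\<in>UNIV. \<Sum>r\<in>UNIV. snd z $ i * conn1 G r i z * pdy r f z) =
      (\<Sum>r\<in>UNIV. (\<Sum>i\<in>UNIV. snd z $ i * conn1 G r i z) * pdy r f z)"
    by (subst sum.swap) (simp add: sum_distrib_right)
  finally show ?thesis
    using f z by (simp add: sum_conn1 along_geodesic_field sum_distrib_left mult_ac)
qed

lemma vhderiv0_eq:
  assumes z: "z \<in> D" and f: "smooth_on D f"
  shows "vhderiv0 G k f z = spray_deriv (pdy k f) z - (\<Sum>r\<in>UNIV. conn1 G r k z * pdy r f z)"
proof -
  have "vhderiv0 G k f z = hderiv0 G (pdy k f) z -
      (\<Sum>j\<in>UNIV. \<Sum>r\<in>UNIV. snd z $ j * conn2 G r k j z * pdy r f z)"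
    by (simp add: vhderiv0_def vhderiv_def hderiv0_def right_diff_distrib sum_subtractf
        sum_distrib_left mult_ac)
  also have "(\<Sum>j\<in>UNIV. \<Sum>r\<in>UNIV. snd z $ j * conn2 G r k j z * pdy r f z) =
      (\<Sum>r\<in>UNIV. (\<Sum>j\<in>UNIV. snd z $ j * conn2 G r k j z) * pdy r f z)"
    by (subst sum.swap) (simp add: sum_distrib_right)
  finally show ?thesis
    using z by (simp add: sum_conn2 hderiv0_eq diff[OF smooth_on_pdy[OF f]])
qed

lemma pdx_spray_deriv:
  assumes "z \<in> D" "smooth_on D f"
  shows "pdx k (spray_deriv f) z =
    spray_deriv (pdx k f) z - 2 * (\<Sum>j\<in>UNIV. pdx k (coef G j) z * pdy j f z)"
  by (rule pdx_along_geodesic_field[OF open_D assms(2,1) diff[OF smooth_G assms(1)]])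

lemma pdy_spray_deriv:
  assumes "z \<in> D" "smooth_on D f"
  shows "pdy k (spray_deriv f) z =
    spray_deriv (pdy k f) z + pdx k f z - 2 * (\<Sum>j\<in>UNIV. conn1 G j k z * pdy j f z)"
  unfolding conn1_def
  by (rule pdy_along_geodesic_field[OF open_D assms(2,1) diff[OF smooth_G assms(1)]])

lemma horizontally_constant_imp_spray_deriv_eq_0:
  assumes "z \<in> D" "f differentiable (at z)" "\<And>k. hderiv G k f z = 0"
  shows "spray_deriv f z = 0"
  using assms hderiv0_eq[of z f] by (simp add: hderiv0_def)

text \<open>Since \<open>S f = 0\<close> everywhere, its vertical derivative \<open>S (f\<^sub>.\<^sub>k) + \<partial>\<^sub>k f - 2 G\<^sup>j\<^sub>k f\<^sub>.\<^sub>j\<close> vanishes too, and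
  \<open>\<partial>\<^sub>k f = G\<^sup>j\<^sub>k f\<^sub>.\<^sub>j\<close> by assumption.\<close>

lemma horizontally_constant_imp_euler_lagrange:
  assumes f: "smooth_on D f" and h: "\<And>w k. w \<in> D \<Longrightarrow> hderiv G k f w = 0" and z: "z \<in> D"
  shows "spray_deriv (pdy k f) z = pdx k f z"
proof -
  have "pdy k (spray_deriv f) z = pdy k (\<lambda>w. 0) z"
    by (rule pdy_open_cong[OF open_D z])
      (use h diff[OF f] horizontally_constant_imp_spray_deriv_eq_0 in blast)
  also have "\<dots> = 0" by (simp add: pdy_def)
  finally show ?thesis using h[OF z, of k] by (simp add: pdy_spray_deriv z f hderiv_def)
qed

text \<open>Conservation of energy comes first: applying \<open>S\<close> to Euler's identity \<open>2 L = y\<^sup>l L\<^sub>.\<^sub>l\<close> and using the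
  Euler-Lagrange equation gives \<open>2 S L = S L\<close>, thus \<open>S L = 0\<close>. The vertical derivative of this equation
  is \<open>2 L\<^sub>;\<^sub>k = 0\<close>.\<close>

lemma euler_lagrange_imp_horizontally_constant:
  assumes L: "smooth_on D L"
    and hom: "\<And>w. w \<in> D \<Longrightarrow> along liouville_field L w = 2 * L w"
    and el: "\<And>w k. w \<in> D \<Longrightarrow> spray_deriv (pdy k L) w = pdx k L w"
    and z: "z \<in> D"
  shows "hderiv G k L z = 0"
proof -
  have zero: "spray_deriv L w = 0" if w: "w \<in> D" for w
  proof -
    note d = diff[OF smooth_on_fibre_coordinate[OF open_D] w] diff[OF smooth_on_pdy[OF L] w]
    have "2 * spray_deriv L w = spray_deriv (\<lambda>w. 2 * L w) w"
      by (simp add: along_def frechet_derivative_cmult diff[OF L w])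
    also have "\<dots> = spray_deriv (\<lambda>w. \<Sum>l\<in>UNIV. snd w $ l * pdy l L w) w"
      by (rule along_open_cong[OF open_D w])
        (use hom along_liouville_field[OF diff[OF L]] in simp)
    also have "\<dots> = (\<Sum>l\<in>UNIV. snd w $ l * spray_deriv (pdy l L) w - 2 * coef G l w * pdy l L w)"
      unfolding along_def
      by (simp add: frechet_derivative_sum frechet_derivative_mult differentiable_mult d
          frechet_derivative_fibre_coordinate geodesic_field_def coef_def)
    also have "\<dots> = spray_deriv L w"
      by (simp add: el[OF w] along_geodesic_field[OF diff[OF L w]] sum_subtractf
          sum_distrib_left mult.assoc)
    finally show ?thesis by simp
  qed
  have "pdy k (spray_deriv L) z = pdy k (\<lambda>w. 0) z"
    by (rule pdy_open_cong[OF open_D z]) (rule zero)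
  then show ?thesis
    by (simp add: pdy_def[of k "\<lambda>w. 0"] pdy_spray_deriv z L el[OF z] hderiv_def)
qed

text \<open>Horizontal constancy is \<open>\<partial>\<^sub>k f = G\<^sup>r\<^sub>k f\<^sub>.\<^sub>r\<close>, which also gives \<open>S f = 0\<close> and \<open>S (f\<^sub>.\<^sub>r) = G\<^sup>j\<^sub>r f\<^sub>.\<^sub>j\<close>. There are
  then two ways to compute \<open>S (\<partial>\<^sub>k f)\<close>: by the product rule it is
  \<open>S (G\<^sup>r\<^sub>k) f\<^sub>.\<^sub>r + G\<^sup>r\<^sub>k G\<^sup>j\<^sub>r f\<^sub>.\<^sub>j\<close>, and by commuting \<open>\<partial>\<^sub>k\<close> with \<open>S\<close> it is \<open>2 \<partial>\<^sub>k G\<^sup>j f\<^sub>.\<^sub>j\<close>. The difference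
  is \<open>R\<^sup>j\<^sub>k f\<^sub>.\<^sub>j\<close>, because \<open>R\<^sup>j\<^sub>k = 2 \<partial>\<^sub>k G\<^sup>j - S (G\<^sup>j\<^sub>k) - G\<^sup>j\<^sub>r G\<^sup>r\<^sub>k\<close>.\<close>

lemma riemann_annihilates_horizontally_constant:
  assumes f: "smooth_on D f" and h: "\<And>w k. w \<in> D \<Longrightarrow> hderiv G k f w = 0" and z: "z \<in> D"
  shows "(\<Sum>i\<in>UNIV. riemann G i k z * pdy i f z) = 0"
proof -
  have riem: "riemann G i k z = 2 * pdx k (coef G i) z - spray_deriv (conn1 G i k) z -
      (\<Sum>j\<in>UNIV. conn1 G i j z * conn1 G j k z)" for i
    using along_geodesic_field[OF diff[OF smooth_conn1 z], of G i k]
    by (simp add: riemann_def conn1_def)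
  have dx: "pdx k f w = (\<Sum>r\<in>UNIV. conn1 G r k w * pdy r f w)" if "w \<in> D" for k w
    using h[OF that, of k] by (simp add: hderiv_def)
  have dy: "spray_deriv (pdy r f) z = (\<Sum>j\<in>UNIV. conn1 G j r z * pdy j f z)" for r
    using horizontally_constant_imp_euler_lagrange[OF f h z, of r] dx[OF z, of r] by simp
  have "spray_deriv (pdx k f) z = spray_deriv (\<lambda>w. \<Sum>r\<in>UNIV. conn1 G r k w * pdy r f w) z"
    by (rule along_open_cong[OF open_D z]) (rule dx)
  also have "\<dots> = (\<Sum>r\<in>UNIV. conn1 G r k z * spray_deriv (pdy r f) z +
      spray_deriv (conn1 G r k) z * pdy r f z)"
    unfolding along_def
    by (simp add: frechet_derivative_sum frechet_derivative_mult differentiable_mult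
        diff[OF smooth_conn1 z] diff[OF smooth_on_pdy[OF f] z])
  also have "\<dots> = (\<Sum>r\<in>UNIV. \<Sum>j\<in>UNIV. conn1 G j r z * conn1 G r k z * pdy j f z) +
      (\<Sum>r\<in>UNIV. spray_deriv (conn1 G r k) z * pdy r f z)"
    by (simp add: dy sum.distrib sum_distrib_left mult_ac)
  also have "(\<Sum>r\<in>UNIV. \<Sum>j\<in>UNIV. conn1 G j r z * conn1 G r k z * pdy j f z) =
      (\<Sum>j\<in>UNIV. (\<Sum>r\<in>UNIV. conn1 G j r z * conn1 G r k z) * pdy j f z)"
    by (subst sum.swap) (simp add: sum_distrib_right)
  finally have 1: "spray_deriv (pdx k f) z =
      (\<Sum>j\<in>UNIV. (\<Sum>r\<in>UNIV. conn1 G j r z * conn1 G r k z) * pdy j f z) +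
      (\<Sum>r\<in>UNIV. spray_deriv (conn1 G r k) z * pdy r f z)" .
  have "pdx k (spray_deriv f) z = pdx k (\<lambda>w. 0) z"
    by (rule pdx_open_cong[OF open_D z])
      (use h diff[OF f] horizontally_constant_imp_spray_deriv_eq_0 in blast)
  then have "spray_deriv (pdx k f) z = 2 * (\<Sum>j\<in>UNIV. pdx k (coef G j) z * pdy j f z)"
    by (simp add: pdx_def[of k "\<lambda>w. 0"] pdx_spray_deriv z f)
  then show ?thesis
    using 1 by (simp add: riem left_diff_distrib sum_subtractf sum_distrib_left mult.assoc)
qed

end

text \<open>Up to locally constant factors, \<open>Q\<^sup>2\<close> is the only horizontally constant function that is
  homogeneous of degree two, provided that the curvature is scalar and nonzero. Contracting the
  curvature with \<open>f\<^sub>.\<^sub>i\<close> for a horizontally constant \<open>f\<close> yields \<open>R f\<^sub>.\<^sub>k = \<tau>\<^sub>k y\<^sup>i f\<^sub>.\<^sub>i\<close>. For \<open>f = Q\<close> this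
  shows \<open>R \<noteq> 0\<close>, for \<open>f = L / Q\<^sup>2\<close> it gives \<open>f\<^sub>.\<^sub>k = 0\<close>.\<close>

lemma horizontally_constant_unique:
  fixes D :: "'n::finite xy set"
  assumes "local_spray D G"
    and L: "smooth_on D L" "pos_homogeneous 2 D L" "\<And>w k. w \<in> D \<Longrightarrow> hderiv G k L w = 0"
    and Q: "smooth_on D Q" "pos_homogeneous 1 D Q" "\<And>w k. w \<in> D \<Longrightarrow> hderiv G k Q w = 0"
    and Q0: "\<And>w. w \<in> D \<Longrightarrow> Q w \<noteq> 0"
    and scalar: "\<And>i k. riemann G i k z = R * (if i = k then 1 else 0) - \<tau> k * snd z $ i"
    and ric: "ricci G z \<noteq> 0" and z: "z \<in> D"
  shows "frechet_derivative (\<lambda>w. L w / (Q w)\<^sup>2) (at z) v = 0"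
proof -
  interpret local_spray D G by fact
  let ?f = "\<lambda>w. L w / (Q w)\<^sup>2"
  have contract: "R * pdy k f z = \<tau> k * along liouville_field f z"
    if f: "smooth_on D f" "\<And>w k. w \<in> D \<Longrightarrow> hderiv G k f w = 0" for f k
  proof -
    have "riemann G i k z * pdy i f z =
        (if i = k then R * pdy k f z else 0) - \<tau> k * (snd z $ i * pdy i f z)" for i
      by (simp add: scalar algebra_simps)
    then have "0 = R * pdy k f z - \<tau> k * (\<Sum>i\<in>UNIV. snd z $ i * pdy i f z)"
      using riemann_annihilates_horizontally_constant[OF f z, of k]
      by (simp add: sum_subtractf sum_distrib_left)
    then show ?thesis using along_liouville_field[OF diff[OF f(1) z]] by simp
  qed
  \<comment> \<open>If \<open>R = 0\<close>, the contraction with \<open>Q\<close> forces \<open>\<tau> = 0\<close>, and the whole curvature tensor vanishes.\<close>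
  have "R \<noteq> 0"
  proof
    assume "R = 0"
    then have "\<tau> k * Q z = 0" for k
      using contract[OF Q(1,3), of k] euler_homogeneous[OF Q(2) z diff[OF Q(1) z]] by simp
    then have "\<tau> k = 0" for k using Q0[OF z] by simp
    then show False using ric \<open>R = 0\<close> by (simp add: ricci_def scalar)
  qed
  have f: "smooth_on D ?f"
    unfolding power2_eq_square using Q0
    by (intro smooth_on_divide smooth_on_mult open_D L Q) auto
  have "pos_homogeneous 0 D ?f"
    using L(2) Q(2) unfolding pos_homogeneous_def by (force simp: power_mult_distrib)
  then have radial: "along liouville_field ?f z = 0"
    using euler_homogeneous[OF _ z diff[OF f z]] by simp
  have L_eq: "L w = ?f w * (Q w * Q w)" if "w \<in> D" for w
    using Q0[OF that] by (simp add: power2_eq_square)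
  \<comment> \<open>Differentiating \<open>L = f Q\<^sup>2\<close> instead of the quotient avoids the quotient rule.\<close>
  have fd: "frechet_derivative L (at w) u =
      ?f w * (2 * Q w * frechet_derivative Q (at w) u) + frechet_derivative ?f (at w) u * (Q w)\<^sup>2"
    if w: "w \<in> D" for w u
  proof -
    note d = diff[OF f w] diff[OF Q(1) w]
    have "frechet_derivative L (at w) u =
        frechet_derivative (\<lambda>w. ?f w * (Q w * Q w)) (at w) u"
      by (rule fun_cong[OF frechet_derivative_open_cong[OF open_D w L_eq]])
    then show ?thesis
      unfolding frechet_derivative_mult[OF d(1) differentiable_mult[OF d(2) d(2)]]
        frechet_derivative_mult[OF d(2) d(2)] by (simp add: power2_eq_square mult.commute)
  qed
  have hf: "hderiv G k ?f w = 0" if w: "w \<in> D" for w k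
  proof -
    have "hderiv G k L w = ?f w * (2 * Q w * hderiv G k Q w) + hderiv G k ?f w * (Q w)\<^sup>2"
      by (simp only: hderiv_def pdx_def pdy_def fd[OF w])
        (simp add: algebra_simps sum.distrib sum_distrib_left)
    then show ?thesis using L(3)[OF w] Q(3)[OF w] Q0[OF w] by simp
  qed
  have dy: "pdy k ?f z = 0" for k
    using contract[OF f hf, of k] radial \<open>R \<noteq> 0\<close> by simp
  then have "pdx k ?f z = 0" for k
    using hf[OF z, of k] by (simp add: hderiv_def)
  then show ?thesis
    using frechet_derivative_eq_sum_partials[OF diff[OF f z], of "fst v" "snd v"] dy by simp
qed

text \<open>With \<open>P = Q\<^sub>;\<^sub>0 / (2 Q)\<close>, the projective change \<open>H = G + P y\<close> has
  \<open>H\<^sup>r\<^sub>k = G\<^sup>r\<^sub>k + P\<^sub>.\<^sub>k y\<^sup>r + P \<delta>\<^sup>r\<^sub>k\<close>, so that the horizontal derivative of \<open>Q\<close> changes by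
  \<open>- (P\<^sub>.\<^sub>k Q + P Q\<^sub>.\<^sub>k) = - (Q\<^sub>;\<^sub>0)\<^sub>.\<^sub>k / 2\<close>. The Hamel equation says that \<open>(Q\<^sub>;\<^sub>0)\<^sub>.\<^sub>k = 2 Q\<^sub>;\<^sub>k\<close>.\<close>

lemma (in local_spray) hamel_spray:
  assumes Q: "smooth_on D Q" "pos_homogeneous 1 D Q" "\<And>w. w \<in> D \<Longrightarrow> Q w \<noteq> 0"
    and hamel: "\<And>w k. w \<in> D \<Longrightarrow> hderiv G k Q w = vhderiv0 G k Q w"
    and H: "\<And>w. w \<in> D \<Longrightarrow> H w = G w + (hderiv0 G Q w / (2 * Q w)) *\<^sub>R snd w"
  shows "local_spray D H" and "z \<in> D \<Longrightarrow> hderiv H k Q z = 0"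
proof -
  define P where "P = (\<lambda>w. spray_deriv Q w / (2 * Q w))"
  note dQ = diff[OF Q(1)]
  have P: "smooth_on D P"
    unfolding P_def using Q(3)
    by (intro smooth_on_divide smooth_on_mult smooth_spray_deriv smooth_on_const open_D Q) auto
  have H': "H w = G w + P w *\<^sub>R snd w" if "w \<in> D" for w
    using H[OF that] hderiv0_eq[OF that dQ[OF that]] by (simp add: P_def)
  have smooth_H: "smooth_on D H"
    by (rule smooth_on_cong[OF open_D, of "\<lambda>w. G w + P w *\<^sub>R snd w"])
      (auto simp: H' intro!: smooth_on_add smooth_on_scaleR smooth_on_snd open_D smooth_G P)
  have dS: "pdy k (spray_deriv Q) w = 2 * hderiv G k Q w" if w: "w \<in> D" for k w
    using hamel[OF w, of k] pdy_spray_deriv[OF w Q(1), of k] vhderiv0_eq[OF w Q(1), of k]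
    by (simp add: hderiv_def)
  \<comment> \<open>The derivative of \<open>S Q = 2 Q P\<close>.\<close>
  have dS_P: "frechet_derivative (spray_deriv Q) (at w) u =
      2 * (Q w * frechet_derivative P (at w) u + frechet_derivative Q (at w) u * P w)"
    if w: "w \<in> D" for w u
  proof -
    note d = dQ[OF w] diff[OF P w]
    have "frechet_derivative (spray_deriv Q) (at w) u =
        frechet_derivative (\<lambda>w. 2 * (Q w * P w)) (at w) u"
      by (rule fun_cong[OF frechet_derivative_open_cong[OF open_D w]]) (simp add: P_def Q(3))
    then show ?thesis
      by (simp add: frechet_derivative_cmult[OF differentiable_mult[OF d]]
          frechet_derivative_mult[OF d])
  qed
  have dH: "frechet_derivative (coef H r) (at w) u = frechet_derivative (coef G r) (at w) u +
      (P w * snd u $ r + frechet_derivative P (at w) u * snd w $ r)" if w: "w \<in> D" for r w u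
  proof -
    note d = diff[OF P w] diff[OF smooth_on_fibre_coordinate[OF open_D] w]
    have "frechet_derivative (coef H r) (at w) u =
        frechet_derivative (\<lambda>w. coef G r w + P w * snd w $ r) (at w) u"
      by (rule fun_cong[OF frechet_derivative_open_cong[OF open_D w]]) (simp add: coef_def H')
    then show ?thesis
      by (simp add: frechet_derivative_add[OF diff[OF smooth_coef w] differentiable_mult[OF d]]
          frechet_derivative_mult[OF d] frechet_derivative_fibre_coordinate)
  qed
  have euler_Q: "along liouville_field Q w = Q w" if w: "w \<in> D" for w
    using euler_homogeneous[OF Q(2) w dQ[OF w]] by simp
  have euler_P: "along liouville_field P w = P w" if w: "w \<in> D" for w
  proof -
    have "along liouville_field (spray_deriv Q) w = (\<Sum>k\<in>UNIV. snd w $ k * (2 * hderiv G k Q w))"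
      by (simp add: along_liouville_field[OF diff[OF smooth_spray_deriv[OF Q(1)] w]] dS[OF w])
    also have "\<dots> = 2 * hderiv0 G Q w" by (simp add: hderiv0_def sum_distrib_left mult_ac)
    also have "\<dots> = 4 * Q w * P w"
      using hderiv0_eq[OF w dQ[OF w]] Q(3)[OF w] by (simp add: P_def)
    finally show ?thesis
      using dS_P[OF w, of "liouville_field w"] euler_Q[OF w] Q(3)[OF w]
      by (simp add: along_def algebra_simps)
  qed
  show "local_spray D H"
  proof
    fix w r assume w: "w \<in> D"
    have "along liouville_field (coef H r) w = along liouville_field (coef G r) w +
        (P w * snd w $ r + along liouville_field P w * snd w $ r)"
      by (simp add: along_def dH[OF w] liouville_field_def)
    then show "along liouville_field (coef H r) w = 2 * coef H r w"
      by (simp add: euler_G[OF w] euler_P[OF w] coef_def H'[OF w])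
  qed (fact open_D smooth_H)+
  assume z: "z \<in> D"
  have "conn1 H r k z * pdy r Q z = conn1 G r k z * pdy r Q z +
      (P z * (axis k 1 $ r * pdy r Q z) + pdy k P z * (snd z $ r * pdy r Q z))" for r
    by (simp add: conn1_def pdy_def[of k] dH[OF z] algebra_simps)
  then have "(\<Sum>r\<in>UNIV. conn1 H r k z * pdy r Q z) = (\<Sum>r\<in>UNIV. conn1 G r k z * pdy r Q z) +
      (P z * pdy k Q z + pdy k P z * Q z)"
    using along_liouville_field[OF dQ[OF z]] euler_Q[OF z]
    by (simp add: sum.distrib sum_distrib_left[symmetric] sum_axis)
  then show "hderiv H k Q z = 0"
    using dS[OF z, of k] dS_P[OF z, of "(0, axis k 1)"]
    by (simp add: hderiv_def pdy_def[of k] mult_ac)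
qed


section \<open>From coordinates to the tangent bundle\<close>

lemma conical_region_subset_tangent_bundle:
  "smooth_atlas A \<Longrightarrow> conical_region A C \<Longrightarrow> C \<subseteq> tangent_bundle A"
  by (simp add: conical_region_def openin_tangent_topology open_in_tangent_bundle_def)

lemma open_in_coords:
  "smooth_atlas A \<Longrightarrow> conical_region A C \<Longrightarrow> c \<in> A \<Longrightarrow> open (in_coords A C c)"
  by (simp add: conical_region_def openin_tangent_topology open_in_tangent_bundle_def in_coords_def)

lemma local_rep_bundle_chart:
  "smooth_atlas A \<Longrightarrow> c \<in> A \<Longrightarrow> v \<in> bundle_dom A c \<Longrightarrow>
    local_rep A c f (bundle_chart c v) = f v"
  by (simp add: local_rep_def inj_on_bundle_chart)

lemma local_rep_power2: "local_rep A c (\<lambda>v. (Q v)\<^sup>2) = (\<lambda>z. (local_rep A c Q z)\<^sup>2)"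
  by (simp add: local_rep_def comp_def)

lemma zero_derivative_imp_constant_on_ball:
  fixes f :: "'a::euclidean_space \<Rightarrow> real"
  assumes "open D" "smooth_on D f" "\<And>w v. w \<in> D \<Longrightarrow> frechet_derivative f (at w) v = 0" "z \<in> D"
  obtains r where "r > 0" "ball z r \<subseteq> D" "\<And>w. w \<in> ball z r \<Longrightarrow> f w = f z"
proof -
  obtain r where r: "r > 0" "ball z r \<subseteq> D" using assms openE by blast
  have "f w = f z" if "w \<in> ball z r" for w
  proof (rule has_derivative_zero_unique[OF convex_ball _ that])
    fix x assume x: "x \<in> ball z r"
    then have "(f has_derivative frechet_derivative f (at x)) (at x)"
      using r by (intro has_frechet_derivative_smooth_on[OF assms(2)]) auto
    moreover have "frechet_derivative f (at x) = (\<lambda>v. 0)" 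
      by (intro ext assms(3)) (use r x in auto)
    ultimately show "(f has_derivative (\<lambda>v. 0)) (at x within ball z r)"
      by (simp add: has_derivative_at_withinI)
  qed (use r in simp)
  then show ?thesis using r that by blast
qed

text \<open>In every chart \<open>f\<close> is constant on small balls. Its level sets and their complements are therefore
  open in the tangent bundle, and a connected set cannot meet both.\<close>

lemma locally_constant_on_connectedin:
  assumes A: "smooth_atlas A" and C: "conical_region A C"
    and f: "\<And>c. c \<in> A \<Longrightarrow> smooth_on (in_coords A C c) (local_rep A c f)"
      "\<And>c z v. c \<in> A \<Longrightarrow> z \<in> in_coords A C c \<Longrightarrow>
        frechet_derivative (local_rep A c f) (at z) v = 0"
    and K: "K \<subseteq> C" "connectedin (tangent_topology A) K" "v \<in> K" "w \<in> K"
  shows "f v = f w"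
proof (rule ccontr)
  assume "f v \<noteq> f w"
  have op: "openin (tangent_topology A) {u \<in> C. f u \<in> B}" (is "openin _ ?W") for B
    unfolding openin_tangent_topology[OF A] open_in_tangent_bundle_def
  proof (intro conjI ballI)
    show "?W \<subseteq> tangent_bundle A" using conical_region_subset_tangent_bundle[OF A C] by blast
    fix c assume c: "c \<in> A"
    have eq: "bundle_chart c ` (?W \<inter> bundle_dom A c) = {z \<in> in_coords A C c. local_rep A c f z \<in> B}"
      using local_rep_bundle_chart[OF A c] by (fastforce simp: in_coords_def)
    show "open (bundle_chart c ` (?W \<inter> bundle_dom A c))"
      unfolding eq open_contains_ball
    proof
      fix z assume z: "z \<in> {z \<in> in_coords A C c. local_rep A c f z \<in> B}"
      obtain r where r: "r > 0" "ball z r \<subseteq> in_coords A C c"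
        and const: "\<And>w. w \<in> ball z r \<Longrightarrow> local_rep A c f w = local_rep A c f z"
        by (rule zero_derivative_imp_constant_on_ball[OF open_in_coords[OF A C c] f(1)[OF c]
              f(2)[OF c]]) (use z in auto)
      have "ball z r \<subseteq> {z \<in> in_coords A C c. local_rep A c f z \<in> B}"
      proof
        fix w assume "w \<in> ball z r"
        then show "w \<in> {z \<in> in_coords A C c. local_rep A c f z \<in> B}"
          using r(2) z const[of w] by auto
      qed
      then show "\<exists>e>0. ball z e \<subseteq> {z \<in> in_coords A C c. local_rep A c f z \<in> B}"
        using r(1) by blast
    qed
  qed
  let ?E = "{u \<in> C. f u \<in> {f v}}" and ?E' = "{u \<in> C. f u \<in> - {f v}}"
  have "K \<subseteq> ?E \<union> ?E'" "?E \<inter> ?E' \<inter> K = {}" using K(1) by auto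
  moreover have "?E \<inter> K \<noteq> {}" "?E' \<inter> K \<noteq> {}" using K(1,3,4) \<open>f v \<noteq> f w\<close> by force+
  ultimately show False using connectedinD[OF K(2) op[of "{f v}"] op[of "- {f v}"]] by blast
qed


section \<open>Metrizability of Hamel sprays\<close>

theorem theorem1p5:
  fixes A :: "('m::{t2_space, second_countable_topology}, 'n::finite) chart set"
    and C :: "('m, 'n) tangent set"
    and G :: "('m, 'n) chart \<Rightarrow> 'n sprayc"
    and Q :: "('m, 'n) tangent \<Rightarrow> real"
  assumes "smooth_atlas A"
    and "spray A C G"
    and "hamel_function A C G Q"
    and "\<forall>v\<in>C. Q v \<noteq> 0"
    and "nonzero_scalar_curvature A C (associated_hamel_spray A G Q)"
  shows "(metrizable A C (associated_hamel_spray A G Q) \<longleftrightarrow> finsler_metric A C (\<lambda>v. (Q v)\<^sup>2)) \<and>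
    (metrizable A C (associated_hamel_spray A G Q) \<longrightarrow>
       induces A C (\<lambda>v. (Q v)\<^sup>2) (associated_hamel_spray A G Q) \<and>
       (\<forall>L. finsler_metric A C L \<and> induces A C L (associated_hamel_spray A G Q) \<longrightarrow>
          (\<forall>K. K \<subseteq> C \<and> connectedin (tangent_topology A) K \<longrightarrow>
             (\<exists>c. c \<noteq> 0 \<and> (\<forall>v\<in>K. L v = c * (Q v)\<^sup>2)))))"
proof -
  let ?H = "associated_hamel_spray A G Q"
  let ?D = "in_coords A C" and ?q = "\<lambda>c. local_rep A c Q"
  let ?f = "\<lambda>L v. L v / (Q v)\<^sup>2"
  have C: "conical_region A C" using assms(2) by (simp add: spray_def)
  note open_coords = open_in_coords[OF assms(1) C]
  have q: "smooth_on (?D c) (?q c)" "pos_homogeneous 1 (?D c) (?q c)" if "c \<in> A" for c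
    using assms(3) that by (simp_all add: hamel_function_def)
  have rep: "\<exists>v\<in>C. \<forall>f. local_rep A c f z = f v" if "c \<in> A" "z \<in> ?D c" for c z
    using that(2) local_rep_bundle_chart[OF assms(1) that(1)] unfolding in_coords_def by blast
  have q0: "?q c z \<noteq> 0" if "c \<in> A" "z \<in> ?D c" for c z
    using rep[OF that] assms(4) by metis
  have hamel: "local_spray (?D c) (?H c)"
    "\<And>z k. z \<in> ?D c \<Longrightarrow> hderiv (?H c) k (?q c) z = 0" if c: "c \<in> A" for c
  proof -
    have G: "smooth_on (?D c) (G c)" "pos_homogeneous 2 (?D c) (G c)"
      using assms(2) c by (simp_all add: spray_def)
    have coef: "pos_homogeneous 2 (?D c) (coef (G c) r)" for r
      using G(2) by (fastforce simp: pos_homogeneous_def coef_def)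
    interpret local_spray "?D c" "G c"
    proof
      fix z r assume z: "z \<in> ?D c"
      show "along liouville_field (coef (G c) r) z = 2 * coef (G c) r z"
        using euler_homogeneous[OF coef z] smooth_on_coef[OF open_coords[OF c] G(1)]
          smooth_on_imp_differentiable z by force
    qed (fact open_coords[OF c] G)+
    show "local_spray (?D c) (?H c)" "\<And>z k. z \<in> ?D c \<Longrightarrow> hderiv (?H c) k (?q c) z = 0"
      by (rule hamel_spray[OF q[OF c] q0[OF c]];
        use assms(3) c in \<open>simp add: hamel_function_def associated_hamel_spray_def\<close>)+
  qed
  have q2: "smooth_on (?D c) (\<lambda>z. (?q c z)\<^sup>2)" if "c \<in> A" for c
    unfolding power2_eq_square using that by (intro smooth_on_mult q open_coords)
  \<comment> \<open>\<open>Q\<^sup>2\<close> inherits horizontal constancy from \<open>Q\<close>, hence satisfies the Euler-Lagrange equation.\<close>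
  have induced: "induces A C (\<lambda>v. (Q v)\<^sup>2) ?H" if fin: "finsler_metric A C (\<lambda>v. (Q v)\<^sup>2)"
    unfolding induces_def local_rep_power2
  proof (intro ballI)
    fix c z assume c: "c \<in> A" and z: "z \<in> ?D c"
    interpret local_spray "?D c" "?H c" by (rule hamel(1)[OF c])
    have inv: "invertible (fundamental_tensor (\<lambda>z. (?q c z)\<^sup>2) z)"
      using fin c z by (simp add: finsler_metric_def local_rep_power2)
    have "hderiv (?H c) k (\<lambda>z. (?q c z)\<^sup>2) w = 0" if w: "w \<in> ?D c" for k w
    proof -
      have d: "?q c differentiable (at w)" using diff[OF q(1)[OF c] w] .
      have "hderiv (?H c) k (\<lambda>z. (?q c z)\<^sup>2) w = 2 * ?q c w * hderiv (?H c) k (?q c) w"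
        unfolding hderiv_def pdx_def pdy_def power2_eq_square frechet_derivative_mult[OF d d]
        by (simp add: algebra_simps sum_distrib_left)
      then show ?thesis using hamel(2)[OF c w] by simp
    qed
    then show "?H c z = metric_spray (\<lambda>z. (?q c z)\<^sup>2) z"
      using along_geodesic_euler_lagrange[OF open_coords[OF c] q2[OF c] z inv]
        horizontally_constant_imp_euler_lagrange[OF q2[OF c] _ z] by blast
  qed
  \<comment> \<open>Any metric that induces the Hamel spray is locally a constant multiple of \<open>Q\<^sup>2\<close>.\<close>
  have quotient: "smooth_on (?D c) (local_rep A c (?f L))"
    "\<And>z v. z \<in> ?D c \<Longrightarrow> frechet_derivative (local_rep A c (?f L)) (at z) v = 0"
    if L: "finsler_metric A C L" "induces A C L ?H" and c: "c \<in> A" for L c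
  proof -
    interpret local_spray "?D c" "?H c" by (rule hamel(1)[OF c])
    let ?l = "local_rep A c L"
    have l: "smooth_on (?D c) ?l" "pos_homogeneous 2 (?D c) ?l"
      "\<And>w. w \<in> ?D c \<Longrightarrow> invertible (fundamental_tensor ?l w)"
      using L(1) c by (simp_all add: finsler_metric_def)
    have f: "local_rep A c (?f L) = (\<lambda>z. ?l z / (?q c z)\<^sup>2)" by (simp add: local_rep_def comp_def)
    show "smooth_on (?D c) (local_rep A c (?f L))"
      unfolding f using q0[OF c] by (intro smooth_on_divide l q2 c open_coords) auto
    have "spray_deriv (pdy k ?l) w = pdx k ?l w" if w: "w \<in> ?D c" for k w
      using along_geodesic_euler_lagrange[OF open_coords[OF c] l(1) w l(3)[OF w], of "?H c"] L(2) c w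
      by (simp add: induces_def)
    then have hl: "hderiv (?H c) k ?l w = 0" if w: "w \<in> ?D c" for k w
      using euler_homogeneous[OF l(2) _ diff[OF l(1)]] w
      by (intro euler_lagrange_imp_horizontally_constant[OF l(1)]) auto
    obtain R \<tau> where "\<And>z i k. z \<in> ?D c \<Longrightarrow>
        riemann (?H c) i k z = R z * (if i = k then 1 else 0) - \<tau> k z * snd z $ i"
      using assms(5) c unfolding nonzero_scalar_curvature_def scalar_curvature_def by metis
    moreover have "ricci (?H c) z \<noteq> 0" if "z \<in> ?D c" for z
      using assms(5) c that by (simp add: nonzero_scalar_curvature_def)
    ultimately show "frechet_derivative (local_rep A c (?f L)) (at z) v = 0"
      if "z \<in> ?D c" for z v
      unfolding f using that
      by (intro horizontally_constant_unique[OF hamel(1)[OF c] l(1,2) hl q[OF c] hamel(2)[OF c]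
          q0[OF c], where R = "R z" and \<tau> = "\<lambda>k. \<tau> k z"]) auto
  qed
  have finsler: "finsler_metric A C (\<lambda>v. (Q v)\<^sup>2)"
    if L: "finsler_metric A C L" "induces A C L ?H" for L
    unfolding finsler_metric_def local_rep_power2
  proof (intro conjI ballI)
    fix c assume c: "c \<in> A"
    show "pos_homogeneous 2 (?D c) (\<lambda>z. (?q c z)\<^sup>2)"
      using q(2)[OF c] by (fastforce simp: pos_homogeneous_def power_mult_distrib)
    fix z assume z: "z \<in> ?D c"
    let ?l = "local_rep A c L"
    note f = quotient[OF L c]
    obtain r where r: "r > 0" "ball z r \<subseteq> ?D c"
      "\<And>w. w \<in> ball z r \<Longrightarrow> local_rep A c (?f L) w = local_rep A c (?f L) z"
      using zero_derivative_imp_constant_on_ball[OF open_coords[OF c] f z] by blast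
    define a where "a = ?l z / (?q c z)\<^sup>2"
    have "?l z \<noteq> 0" using rep[OF c z] L(1) unfolding finsler_metric_def by metis
    then have a: "a \<noteq> 0" using q0[OF c z] by (simp add: a_def)
    have "?l w = a * (?q c w)\<^sup>2" if w: "w \<in> ball z r" for w
      using r(3)[OF w] q0[OF c, of w] r(2) w by (auto simp: a_def local_rep_def field_simps)
    moreover have "smooth_on (ball z r) (\<lambda>z. (?q c z)\<^sup>2)"
      using smooth_on_subset[OF q2[OF c] r(2)] .
    ultimately have "fundamental_tensor ?l z =
        a *\<^sub>R fundamental_tensor (\<lambda>z. (?q c z)\<^sup>2) z"
      using r(1) by (intro fundamental_tensor_cmult[of "ball z r"]) auto
    moreover have "invertible (fundamental_tensor ?l z)"
      using L(1) c z by (simp add: finsler_metric_def)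
    ultimately show "invertible (fundamental_tensor (\<lambda>z. (?q c z)\<^sup>2) z)"
      using a scalar_invertible[of "inverse a" "fundamental_tensor ?l z"] by simp
  qed (use C assms(4) q2 in auto)
  have unique: "\<exists>a. a \<noteq> 0 \<and> (\<forall>v\<in>K. L v = a * (Q v)\<^sup>2)"
    if L: "finsler_metric A C L" "induces A C L ?H"
      and K: "K \<subseteq> C" "connectedin (tangent_topology A) K" for L K
  proof (cases "K = {}")
    case False
    then obtain u where u: "u \<in> K" by blast
    have eq: "?f L v = ?f L u" if "v \<in> K" for v
      by (rule locally_constant_on_connectedin[OF assms(1) C _ _ K that u])
        (use quotient[OF L] in blast)+
    have nz: "L v \<noteq> 0" "Q v \<noteq> 0" if "v \<in> K" for v
      using that K(1) L(1) assms(4) by (auto simp: finsler_metric_def)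
    have "L v = ?f L u * (Q v)\<^sup>2" if "v \<in> K" for v
      using eq[OF that] nz(2)[OF that] by (simp add: field_simps)
    then show ?thesis using nz[OF u] by (intro exI[of _ "?f L u"]) auto
  qed (auto intro: exI[of _ 1])
  show ?thesis
    using induced finsler unique unfolding metrizable_def by blast
qed

end
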